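(* Let $X$ be a birth and death process on $\mathbb{N}$ absorbed at $0$, with birth rates $(b_i)_{i\ge 0}$ and death rates $(d_i)_{i\ge 0}$ satisfying $b_0=d_0=0$, $b_i>0$ and $d_i>0$ for all $i\ge 1$, and $\sum_{n=1}^{\infty}\frac{d_1d_2\cdots d_n}{b_1b_2\cdots b_n}=+\infty$, and let $\mathcal{L}$ be its infinitesimal generator. Assume that there exist $C>0$, $\lambda_1>d_1$ and $\phi:\mathbb{N}\to\mathbb{R}_+$ such that $\phi(i)\to\infty$ when $i\to\infty$ and $$\mathcal{L}\phi(i)\le -\lambda_1\phi(i)+C,\quad \forall i\ge 1.$$ Then $X$ admits a quasi-stationary distribution and $X$ is $\xi_1$-positive recurrent.
   Context: $\mathbb{N}=\{0,1,2,\ldots\}$, $\mathbb{N}^*=\{1,2,\ldots\}$, $\mathbb{R}_+=[0,\infty)$. The birth and death process $X=(X_t)_{t\ge0}$ with rates $(b_i),(d_i)$ is the $\mathbb{N}$-valued continuous-time pure jump Markov process which jumps from $i\ge1$ to $i+1$ at rate $b_i$, to $i-1$ at rate $d_i$, and to any other state at rate $0$; the state $0$ is absorbing. Under the condition $\sum_{n\ge1}\frac{d_1\cdots d_n}{b_1\cdots b_n}=+\infty$, the process is non-explosive and $T_0=\inf\{t\ge0: X_t=0\}$ is finite almost surely for every initial law. $\mathbb{P}_\mu$ denotes the law of $X$ with initial distribution $\mu$, and $\mathbb{P}_x=\mathbb{P}_{\delta_x}$. Generator: for any function $\phi$ on $\mathbb{N}$ and $i\ge1$, $\mathcal{L}\phi(i)=b_i(\phi(i+1)-\phi(i))+d_i(\phi(i-1)-\phi(i))$,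 and $\mathcal{L}\phi(0)=0$. Quasi-stationary distribution: a probability measure $\rho$ on $\mathbb{N}^*$ such that $\mathbb{P}_\rho(X_t\in\cdot\mid t<T_0)=\rho(\cdot)$ for all $t\ge0$. Polynomials $Q_n$ and the number $\xi_1$: for $x\in\mathbb{R}$, $Q_1(x)=1$, $b_1Q_2(x)=b_1+d_1-x$, and $b_nQ_{n+1}(x)=(b_n+d_n-x)Q_n(x)-d_nQ_{n-1}(x)$ for $n\ge2$. The number $\xi_1\ge0$ is the unique non-negative number such that, for real $x$, $x\le\xi_1$ if and only if $Q_n(x)>0$ for all $n\ge1$ (it is known that such a number exists and is unique). $X$ is said to be $\xi_1$-positive recurrent if $\xi_1>0$ and, for some $i\ge1$ (and hence for all $i\ge1$), $\lim_{t\to\infty}e^{\xi_1t}\,\mathbb{P}_i(X_t=i)>0$. *)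

theory Defs
  imports "HOL-Probability.Probability"
begin

text \<open>
  Jump rates. The diagonal entry is minus the total jump rate out of \<open>i\<close>. For \<open>b 0 = d 0 = 0\<close>
  the whole row of \<open>0\<close> vanishes, which makes \<open>0\<close> absorbing.
\<close>

definition bd_rate :: "(nat \<Rightarrow> real) \<Rightarrow> (nat \<Rightarrow> real) \<Rightarrow> nat \<Rightarrow> nat \<Rightarrow> real" where
  "bd_rate b d i j =
     (if j = i + 1 then b i
      else if i = j + 1 then d i
      else if i = j then - (b i + d i)
      else 0)"

definition history :: "'w measure \<Rightarrow> (real \<Rightarrow> 'w \<Rightarrow> nat) \<Rightarrow> real \<Rightarrow> 'w measure" where
  "history \<Omega> X s =
     sigma (space \<Omega>) {X u -` A \<inter> space \<Omega> | u A. 0 \<le> u \<and> u \<le> s}"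

text \<open>
  A birth and death process is a Markov family: one process \<open>X\<close> (only times \<open>t \<ge> 0\<close> matter) on a
  measurable space \<open>\<Omega>\<close> (whose measure is irrelevant), together with a law \<open>P x\<close> on \<open>\<Omega>\<close> for
  every starting state \<open>x\<close>. Right-continuity for the discrete topology of \<open>\<nat>\<close> says
  that paths stay for a positive time in each state they visit. Non-explosion is not required
  beyond \<open>X t\<close> having values in \<open>\<nat>\<close>.
  Since the state space is countable, the Markov property
  \<open>P x (X (s + t) = j | history up to s) = P (X s) (X t = j)\<close> can be written without conditional
  expectations, separately on each event \<open>X s = i\<close>.
\<close>

locale birth_death_process =
  fixes b d :: "nat \<Rightarrow> real"
    and \<Omega> :: "'w measure"
    and P :: "nat \<Rightarrow> 'w measure"
    and X :: "real \<Rightarrow> 'w \<Rightarrow> nat"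
  assumes prob_space_P: "prob_space (P x)"
    and sets_P: "sets (P x) = sets \<Omega>"
    and measurable_X: "0 \<le> t \<Longrightarrow> X t \<in> measurable \<Omega> (count_space UNIV)"
    and right_continuous:
      "\<omega> \<in> space \<Omega> \<Longrightarrow> 0 \<le> t \<Longrightarrow> eventually (\<lambda>s. X s \<omega> = X t \<omega>) (at_right t)"
    and start: "AE \<omega> in P x. X 0 \<omega> = x"
    and markov:
      "0 \<le> s \<Longrightarrow> 0 \<le> t \<Longrightarrow> A \<in> sets (history \<Omega> X s) \<Longrightarrow>
         measure (P x) {\<omega> \<in> A. X s \<omega> = i \<and> X (s + t) \<omega> = j} =
         measure (P x) {\<omega> \<in> A. X s \<omega> = i} * measure (P i) {\<omega> \<in> space \<Omega>. X t \<omega> = j}"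
    and jump_rates:
      "((\<lambda>t. measure (P i) {\<omega> \<in> space \<Omega>. X t \<omega> = j}) has_real_derivative bd_rate b d i j)
         (at 0 within {0..})"

definition initial_law :: "(nat \<Rightarrow> 'w measure) \<Rightarrow> nat pmf \<Rightarrow> 'w measure" where
  "initial_law P \<mu> = bind (measure_pmf \<mu>) P"

definition extinction_time :: "(real \<Rightarrow> 'w \<Rightarrow> nat) \<Rightarrow> 'w \<Rightarrow> ereal" where
  "extinction_time X \<omega> = Inf (ereal ` {t. 0 \<le> t \<and> X t \<omega> = 0})"

definition generator :: "(nat \<Rightarrow> real) \<Rightarrow> (nat \<Rightarrow> real) \<Rightarrow> (nat \<Rightarrow> real) \<Rightarrow> nat \<Rightarrow> real" where
  "generator b d \<phi> i =
     (if i = 0 then 0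
      else b i * (\<phi> (i + 1) - \<phi> i) + d i * (\<phi> (i - 1) - \<phi> i))"

text \<open>
  A probability measure on the positive naturals is represented by a \<open>nat pmf\<close> without mass at
  \<open>0\<close>. If \<open>t < T\<^sub>0\<close> had probability \<open>0\<close>, then \<open>cond_prob\<close> would vanish by convention, and the
  equation would fail for \<open>A = UNIV\<close>.
\<close>

definition quasi_stationary_distribution ::
    "(nat \<Rightarrow> 'w measure) \<Rightarrow> (real \<Rightarrow> 'w \<Rightarrow> nat) \<Rightarrow> nat pmf \<Rightarrow> bool" where
  "quasi_stationary_distribution P X \<rho> \<longleftrightarrow>
     0 \<notin> set_pmf \<rho> \<and>
     (\<forall>t\<ge>0. \<forall>A. cond_prob (initial_law P \<rho>)
                     (\<lambda>\<omega>. X t \<omega> \<in> A) (\<lambda>\<omega>. ereal t < extinction_time X \<omega>)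
                 = measure (measure_pmf \<rho>) A)"

text \<open>
  With the convention \<open>Q\<^sub>0 = 0\<close>, the last equation covers both
  \<open>b\<^sub>1 Q\<^sub>2(x) = b\<^sub>1 + d\<^sub>1 - x\<close> and the three-term recurrence for larger indices.
\<close>

fun bd_Q :: "(nat \<Rightarrow> real) \<Rightarrow> (nat \<Rightarrow> real) \<Rightarrow> nat \<Rightarrow> real \<Rightarrow> real" where
  "bd_Q b d 0 x = 0"
| "bd_Q b d (Suc 0) x = 1"
| "bd_Q b d (Suc (Suc n)) x =
     ((b (Suc n) + d (Suc n) - x) * bd_Q b d (Suc n) x - d (Suc n) * bd_Q b d n x) / b (Suc n)"

definition xi1 :: "(nat \<Rightarrow> real) \<Rightarrow> (nat \<Rightarrow> real) \<Rightarrow> real" where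
  "xi1 b d = (THE \<xi>. 0 \<le> \<xi> \<and> (\<forall>x. x \<le> \<xi> \<longleftrightarrow> (\<forall>n\<ge>1. bd_Q b d n x > 0)))"

definition xi1_positive_recurrent ::
    "(nat \<Rightarrow> real) \<Rightarrow> (nat \<Rightarrow> real) \<Rightarrow> (nat \<Rightarrow> 'w measure) \<Rightarrow> (real \<Rightarrow> 'w \<Rightarrow> nat) \<Rightarrow> bool" where
  "xi1_positive_recurrent b d P X \<longleftrightarrow>
     xi1 b d > 0 \<and>
     (\<exists>i\<ge>1. \<exists>L>0. ((\<lambda>t. exp (xi1 b d * t) * measure (P i) {\<omega> \<in> space (P i). X t \<omega> = i})
                     \<longlongrightarrow> L) at_top)"

end

theory Submission
  imports Defs
begin

text \<open>
  Write \<open>\<pi>\<close> for the reversing weights of the process on the positive integers and \<open>q = Q \<xi>\<close> for the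
  eigenfunction at the critical level. As the scale function is unbounded, a negative flux
  \<open>\<pi> n * b n * (q (n + 1) - q n)\<close> would make \<open>q\<close> negative eventually; hence \<open>\<xi> \<le> d 1\<close>, \<open>q\<close> is
  nondecreasing, and \<open>\<Sum>n. \<pi> n * q n\<close> is finite. Adding to \<open>\<phi>\<close> a bounded function that handles finitely
  many states yields a positive supersolution, so \<open>\<xi> > 0\<close>. Beyond a finite set, \<open>\<phi>\<close> is a strict
  supersolution at level \<open>\<xi>\<close>, because \<open>\<lambda>\<^sub>1 > d 1 \<ge> \<xi>\<close>; comparing Wronskians, maximality of \<open>\<xi>\<close> forces
  \<open>q = O(\<phi>)\<close> and \<open>\<Sum>n. \<pi> n * q n * \<phi> n < \<infinity>\<close>, hence \<open>\<Sum>n. \<pi> n * (q n)\<^sup>2 < \<infinity>\<close>.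

  The transition probabilities \<open>p\<close> solve the backward equation, for which \<open>\<phi>\<close> provides a maximum
  principle. Comparison with finite truncations shows that \<open>p\<close> is reversible with respect to \<open>\<pi>\<close>, and
  comparison with sub- and supersolutions that \<open>\<Sum>j. p t i j * q j = exp (- \<xi> * t) * q i\<close>. By
  reversibility the normalised weights \<open>\<pi> * q\<close> are then quasi-stationary. The function
  \<open>f t = exp (\<xi> * t) * p t 1 1\<close> is at most \<open>1\<close> and, as \<open>f (s + t)\<close> is an inner product of rows of the
  semigroup, midpoint convex; so it is nonincreasing and converges. By Cauchy-Schwarz it is at least
  \<open>1 / (\<Sum>n. \<pi> n * (q n)\<^sup>2)\<close>.
\<close>

section \<open>Birth and death recurrences\<close>

text \<open>The empty product gives \<open>\<pi> 1 = 1\<close>. It also gives the conventional value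
  \<open>1\<close> at the absorbing state, where the functions summed against \<open>\<pi>\<close>
  vanish.\<close>

definition bd_pi :: "(nat \<Rightarrow> real) \<Rightarrow> (nat \<Rightarrow> real) \<Rightarrow> nat \<Rightarrow> real" where
  "bd_pi b d n = (\<Prod>k=1..<n. b k / d (Suc k))"

text \<open>For \<open>v = 1\<close> this is the flux of \<open>u\<close> across the edge from
  \<open>n\<close> to \<open>Suc n\<close>.\<close>

definition bd_wronskian ::
  "(nat \<Rightarrow> real) \<Rightarrow> (nat \<Rightarrow> real) \<Rightarrow> (nat \<Rightarrow> real) \<Rightarrow> (nat \<Rightarrow> real) \<Rightarrow> nat \<Rightarrow> real" where
  "bd_wronskian b d u v n = bd_pi b d n * b n * (u (Suc n) * v n - u n * v (Suc n))"

lemma continuous_bd_Q: "isCont (\<lambda>x. bd_Q b d n x) x"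
  by (induction n rule: induct_nat_012) (auto intro!: continuous_intros simp: divide_inverse)

locale bd_rates =
  fixes b d :: "nat \<Rightarrow> real"
  assumes b_0: "b 0 = 0" and d_0: "d 0 = 0"
    and b_pos: "i \<ge> 1 \<Longrightarrow> b i > 0" and d_pos: "i \<ge> 1 \<Longrightarrow> d i > 0"
begin

abbreviation "\<pi> \<equiv> bd_pi b d"
abbreviation "Q x n \<equiv> bd_Q b d n x"
abbreviation "L \<equiv> generator b d"
abbreviation "W \<equiv> bd_wronskian b d"

lemma b_nonneg: "b i \<ge> 0" and d_nonneg: "d i \<ge> 0"
  using b_0 d_0 b_pos[of i] d_pos[of i] by (cases i; force)+

lemma pi_pos: "\<pi> n > 0"
  unfolding bd_pi_def by (rule prod_pos) (auto intro!: divide_pos_pos b_pos d_pos)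

lemma pi_nonneg: "\<pi> n \<ge> 0"
  using pi_pos[of n] by simp

lemma pi_1: "\<pi> (Suc 0) = 1"
  by (simp add: bd_pi_def)

lemma pi_Suc: "n \<ge> 1 \<Longrightarrow> \<pi> (Suc n) * d (Suc n) = \<pi> n * b n"
  using d_pos[of "Suc n"] by (simp add: bd_pi_def)

section \<open>The Lagrange identity and comparison at a fixed level\<close>

lemma generator_add: "L (\<lambda>i. u i + v i) i = L u i + L v i"
  by (simp add: generator_def algebra_simps)

lemma generator_diff: "L (\<lambda>i. u i - v i) i = L u i - L v i"
  by (simp add: generator_def algebra_simps)

lemma generator_scale: "L (\<lambda>i. c * u i) i = c * L u i"
  by (simp add: generator_def algebra_simps)

lemma generator_scale_right: "L (\<lambda>i. u i * c) i = L u i * c"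
  by (simp add: generator_def algebra_simps)

text \<open>The convention \<open>Q x 0 = 0\<close> makes \<open>Q x\<close> an eigenfunction with
  zero boundary value, so the equation also holds at \<open>i = 1\<close>.\<close>

lemma generator_Q: "i \<ge> 1 \<Longrightarrow> L (Q x) i = - x * Q x i"
  using b_pos[of i] by (cases i) (auto simp: generator_def field_simps)

lemma lagrange_identity_1:
  "W u v (Suc 0) = v 1 * L u 1 - u 1 * L v 1 + d 1 * (u 1 * v 0 - u 0 * v 1)"
  by (simp add: bd_wronskian_def generator_def pi_1 algebra_simps)

text \<open>Summation by parts: by \<open>pi_Suc\<close>, the downward part of the generator at
  \<open>Suc n\<close> is the flux already counted by \<open>W u v n\<close>.\<close>

lemma lagrange_identity_Suc:
  assumes "n \<ge> 1"
  shows "W u v (Suc n) = W u v n + \<pi> (Suc n) * (v (Suc n) * L u (Suc n) - u (Suc n) * L v (Suc n))"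
  unfolding bd_wronskian_def generator_def pi_Suc[OF assms, symmetric]
  by (simp add: algebra_simps)

text \<open>A nonnegative Wronskian means that \<open>u / v\<close> does not decrease from
  \<open>n\<close> to \<open>Suc n\<close>.\<close>

lemma wronskian_nonneg_pos:
  assumes "n \<ge> 1" "W u v n \<ge> 0" "u n > 0" "v n > 0" "v (Suc n) > 0"
  shows "u (Suc n) > 0"
proof -
  have "u (Suc n) * v n - u n * v (Suc n) \<ge> 0"
    using assms(2) mult_pos_pos[OF pi_pos[of n] b_pos[OF assms(1)]]
    unfolding bd_wronskian_def by (simp add: zero_le_mult_iff)
  moreover have "u n * v (Suc n) > 0" using assms by simp
  ultimately have "u (Suc n) * v n > 0" by linarith
  thus ?thesis using assms(4) by (simp add: zero_less_mult_iff)
qed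

text \<open>A positive supersolution \<open>v\<close> at level \<open>x\<close> propagates positivity of \<open>Q x\<close>: as long
  as \<open>Q x\<close> is positive, the Wronskian grows.\<close>

lemma Q_pos_from:
  assumes "m \<ge> 1" and W: "W (Q x) v m \<ge> 0" and Qm: "Q x m > 0"
    and v: "\<And>n. n \<ge> m \<Longrightarrow> v n > 0" and Lv: "\<And>n. n > m \<Longrightarrow> L v n \<le> - x * v n"
    and "n \<ge> m"
  shows "Q x n > 0"
proof -
  have "W (Q x) v n \<ge> 0 \<and> Q x n > 0"
    using \<open>n \<ge> m\<close>
  proof (induction n rule: dec_induct)
    case base
    then show ?case using W Qm by simp
  next
    case (step n)
    have n1: "n \<ge> 1" using step.hyps \<open>m \<ge> 1\<close> by simp
    have Q: "Q x (Suc n) > 0"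
      using wronskian_nonneg_pos[OF n1, of "Q x" v] step v[of n] v[of "Suc n"] by simp
    have "Q x (Suc n) * L v (Suc n) \<le> Q x (Suc n) * (- x * v (Suc n))"
      using Lv[of "Suc n"] step.hyps Q by (intro mult_left_mono) auto
    then have "0 \<le> v (Suc n) * L (Q x) (Suc n) - Q x (Suc n) * L v (Suc n)"
      unfolding generator_Q[of "Suc n" x, simplified] by (simp add: algebra_simps)
    then have "W (Q x) v (Suc n) \<ge> 0"
      unfolding lagrange_identity_Suc[OF n1] using step pi_pos[of "Suc n"] by simp
    then show ?case using Q by simp
  qed
  then show ?thesis by simp
qed

text \<open>The comparison can start at \<open>1\<close>, because the boundary term there is
  \<open>d 1 * v 0 \<ge> 0\<close>.\<close>

lemma Q_pos_of_supersolution: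
  assumes v0: "v 0 \<ge> 0" and v: "\<And>n. n \<ge> 1 \<Longrightarrow> v n > 0"
    and Lv: "\<And>n. n \<ge> 1 \<Longrightarrow> L v n \<le> - x * v n" and "n \<ge> 1"
  shows "Q x n > 0"
proof (rule Q_pos_from[of 1])
  show "W (Q x) v 1 \<ge> 0"
    using lagrange_identity_1[of "Q x" v] generator_Q[of 1 x] Lv[of 1] mult_nonneg_nonneg[OF d_nonneg[of 1] v0]
    by (simp add: mult.commute)
qed (use assms in auto)

text \<open>A positive \<open>Q y\<close> is itself a supersolution at every level
  \<open>x \<le> y\<close>.\<close>

lemma Q_pos_antimono:
  assumes "\<And>n. n \<ge> 1 \<Longrightarrow> Q y n > 0" "x \<le> y" "n \<ge> 1"
  shows "Q x n > 0"
proof (rule Q_pos_of_supersolution[of "Q y"])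
  fix n :: nat assume "n \<ge> 1"
  then show "L (Q y) n \<le> - x * Q y n"
    using assms(1)[of n] assms(2) by (simp add: generator_Q mult_right_mono)
qed (use assms in auto)

end

section \<open>Scale function, flux and existence of the critical level\<close>

locale bd_rates_divergent = bd_rates +
  assumes divergent: "filterlim (\<lambda>N. \<Sum>n=1..N. (\<Prod>k=1..n. d k) / (\<Prod>k=1..n. b k)) at_top sequentially"
begin

text \<open>Up to the factor \<open>d 1\<close>, the terms of the divergent series are the
  increments of the scale function.\<close>

lemma scale_increment:
  assumes "n \<ge> 1"
  shows "(\<Prod>k=1..n. d k) / (\<Prod>k=1..n. b k) = d 1 / (\<pi> n * b n)"
proof -
  have "\<pi> n * b n * (\<Prod>k=1..n. d k) = d 1 * (\<Prod>k=1..n. b k)"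
    using assms
  proof (induction n rule: dec_induct)
    case (step n)
    have "\<pi> (Suc n) * b (Suc n) * (\<Prod>k=1..Suc n. d k)
        = (\<pi> (Suc n) * d (Suc n)) * b (Suc n) * (\<Prod>k=1..n. d k)" by simp
    also have "\<dots> = (\<pi> n * b n * (\<Prod>k=1..n. d k)) * b (Suc n)"
      using pi_Suc[OF step.hyps(1)] by simp
    also have "\<dots> = d 1 * (\<Prod>k=1..Suc n. b k)" using step.IH by simp
    finally show ?case .
  qed (simp add: pi_1)
  then have "(\<Prod>k=1..n. d k) * (\<pi> n * b n) = d 1 * (\<Prod>k=1..n. b k)"
    by (simp only: mult.commute)
  moreover have "(\<Prod>k=1..n. b k) \<noteq> 0" using b_pos by (force simp: less_le)
  moreover have "\<pi> n * b n \<noteq> 0" using pi_pos[of n] b_pos[OF assms] by simp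
  ultimately show ?thesis by (metis frac_eq_eq)
qed

text \<open>This is the Lagrange identity against the constant \<open>1\<close>, which the generator
  annihilates; the term \<open>d 1\<close> comes from the edge to the absorbing state.\<close>

lemma flux_eq:
  assumes "n \<ge> 1"
  shows "W (Q x) (\<lambda>_. 1) n = d 1 - x * (\<Sum>k=1..n. \<pi> k * Q x k)"
  using assms
proof (induction n rule: dec_induct)
  case base
  then show ?case using lagrange_identity_1[of "Q x" "\<lambda>_. 1"] generator_Q[of 1 x]
    by (simp add: pi_1 generator_def)
next
  case (step n)
  then show ?case
    using lagrange_identity_Suc[of n "Q x" "\<lambda>_. 1"] generator_Q[of "Suc n" x]
    by (simp add: generator_def[of _ _ "\<lambda>_. 1"] algebra_simps)
qed

lemma Q_Suc_diff: "n \<ge> 1 \<Longrightarrow> Q x (Suc n) - Q x n = W (Q x) (\<lambda>_. 1) n / (\<pi> n * b n)"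
  unfolding bd_wronskian_def using pi_pos[of n] b_pos[of n] by auto

text \<open>A negative flux would stay bounded away from \<open>0\<close> and, the scale function being unbounded,
  would drive \<open>Q x\<close> below \<open>0\<close>.\<close>

lemma flux_nonneg:
  assumes pos: "\<And>n. n \<ge> 1 \<Longrightarrow> Q x n > 0" and "x \<ge> 0" and "m \<ge> 1"
  shows "W (Q x) (\<lambda>_. 1) m \<ge> 0"
proof (rule ccontr)
  let ?F = "W (Q x) (\<lambda>_. 1)"
  let ?S = "\<lambda>N. \<Sum>n=1..N. (\<Prod>k=1..n. d k) / (\<Prod>k=1..n. b k)"
  assume "\<not> ?thesis"
  then have neg: "?F m < 0" by simp
  have mono: "?F n \<le> ?F m" if "n \<ge> m" for n
  proof -
    have "(\<Sum>k=1..m. \<pi> k * Q x k) \<le> (\<Sum>k=1..n. \<pi> k * Q x k)"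
      using that pos pi_pos by (intro sum_mono2) (auto intro!: mult_nonneg_nonneg simp: less_imp_le)
    then show ?thesis using flux_eq[of n x] flux_eq[of m x] that \<open>m \<ge> 1\<close> \<open>x \<ge> 0\<close>
      by (simp add: mult_left_mono)
  qed
  \<comment> \<open>Every increment of \<open>Q x\<close> from \<open>m\<close> on is at most
    \<open>?F m / d 1\<close> times the corresponding increment of the scale sums.\<close>
  have bound: "Q x (Suc n) \<le> Q x m + ?F m * (?S n - ?S (m - 1)) / d 1" if "n \<ge> m" for n
    using that
  proof (induction n rule: dec_induct)
    case base
    have "?S m - ?S (m - 1) = d 1 / (\<pi> m * b m)"
      using \<open>m \<ge> 1\<close> scale_increment[of m] by (cases m) auto
    then show ?case using Q_Suc_diff[of m x] \<open>m \<ge> 1\<close> d_pos[of 1] by simp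
  next
    case (step n)
    have n1: "Suc n \<ge> 1" by simp
    have "?F (Suc n) / (\<pi> (Suc n) * b (Suc n)) \<le> ?F m / (\<pi> (Suc n) * b (Suc n))"
      using mono[of "Suc n"] step.hyps pi_pos[of "Suc n"] b_pos[OF n1] by (intro divide_right_mono) auto
    moreover have "?S (Suc n) = ?S n + d 1 / (\<pi> (Suc n) * b (Suc n))"
      using scale_increment[OF n1] by simp
    ultimately show ?case using step.IH Q_Suc_diff[OF n1, of x] d_pos[of 1]
      by (simp add: add_divide_distrib diff_divide_distrib distrib_left right_diff_distrib)
  qed
  \<comment> \<open>Once the scale sum reaches \<open>B\<close>, the right-hand side of
    \<open>bound\<close> is at most \<open>0\<close>.\<close>
  define B where "B = ?S (m - 1) - Q x m * d 1 / ?F m"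
  have "eventually (\<lambda>n. ?S n \<ge> B \<and> n \<ge> m) sequentially"
    using divergent eventually_ge_at_top[of m]
    by (auto simp: filterlim_at_top eventually_conj_iff)
  then obtain n where n: "?S n \<ge> B" "n \<ge> m" by (auto simp: eventually_sequentially)
  have "?F m * (?S n - ?S (m - 1)) \<le> ?F m * (- (Q x m * d 1 / ?F m))"
    using n neg unfolding B_def by (intro mult_left_mono_neg) auto
  also have "\<dots> = - Q x m * d 1" using neg by simp
  finally have "?F m * (?S n - ?S (m - 1)) / d 1 \<le> - Q x m"
    using d_pos[of 1] by (simp add: field_simps)
  then show False using bound[OF n(2)] pos[of "Suc n"] by simp
qed

lemma Q_mono:
  assumes "\<And>n. n \<ge> 1 \<Longrightarrow> Q x n > 0" "x \<ge> 0"
  shows "mono (Q x)"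
proof (rule mono_iff_le_Suc[THEN iffD2], rule allI)
  fix n show "Q x n \<le> Q x (Suc n)"
  proof (cases "n \<ge> 1")
    case True
    have "Q x (Suc n) - Q x n \<ge> 0" unfolding Q_Suc_diff[OF True]
      using flux_nonneg[OF assms True] pi_pos[of n] b_pos[OF True] by simp
    then show ?thesis by simp
  next
    case False
    then show ?thesis by (cases n) auto
  qed
qed

text \<open>For \<open>x \<ge> 0\<close>, the flux across the edge from \<open>1\<close> to
  \<open>2\<close> is \<open>d 1 - x\<close> and cannot be negative.\<close>

lemma Q_pos_imp_le:
  assumes "\<And>n. n \<ge> 1 \<Longrightarrow> Q x n > 0"
  shows "x \<le> d 1"
proof (cases "x \<ge> 0")
  case True
  then show ?thesis using flux_nonneg[OF assms, of 1] flux_eq[of 1 x] by (simp add: pi_1)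
qed (use d_pos[of 1] in simp)

text \<open>The levels at which all polynomials are positive form a down-set bounded by
  \<open>d 1\<close>. Its supremum works because it is attained.\<close>

lemma xi1_exists:
  assumes x0: "x\<^sub>0 \<ge> 0" "\<And>n. n \<ge> 1 \<Longrightarrow> Q x\<^sub>0 n > 0"
  shows "\<exists>\<xi>\<ge>x\<^sub>0. \<forall>x. x \<le> \<xi> \<longleftrightarrow> (\<forall>n\<ge>1. Q x n > 0)"
proof -
  define G where "G = {x. \<forall>n\<ge>1. Q x n > 0}"
  define \<xi> where "\<xi> = Sup G"
  have bdd: "bdd_above G" using Q_pos_imp_le by (auto simp: G_def bdd_above_def)
  have ne: "x\<^sub>0 \<in> G" using x0 by (simp add: G_def)
  have upper: "x \<le> \<xi>" if "x \<in> G" for x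
    unfolding \<xi>_def using that bdd by (rule cSup_upper)
  have lower: "x \<in> G" if "x < \<xi>" for x
  proof -
    have "\<exists>y\<in>G. x < y" using that ne bdd unfolding \<xi>_def by (subst (asm) less_cSup_iff) auto
    then obtain y where "y \<in> G" "x < y" by blast
    then show ?thesis using Q_pos_antimono[of y x] by (auto simp: G_def)
  qed
  have nonneg: "Q \<xi> n \<ge> 0" if "n \<ge> 1" for n
  proof (rule tendsto_lowerbound)
    show "((\<lambda>x. Q x n) \<longlongrightarrow> Q \<xi> n) (at_left \<xi>)"
      using continuous_bd_Q[of \<xi> b d n] by (simp add: isCont_def filterlim_at_split)
    have "\<forall>\<^sub>F x in at_left \<xi>. x < \<xi>" by (simp add: eventually_at_filter)
    then show "\<forall>\<^sub>F x in at_left \<xi>. 0 \<le> Q x n"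
      by eventually_elim (use lower that in \<open>auto simp: G_def less_imp_le\<close>)
  qed simp
  have "Q \<xi> n > 0" if "n \<ge> 1" for n
    using that
  proof (induction n rule: dec_induct)
    case (step n)
    show ?case
    proof (rule ccontr)
      assume "\<not> ?thesis"
      \<comment> \<open>Continuity alone leaves room for a zero, but the recurrence would turn a
        zero after a positive value into a negative value.\<close>
      then have 0: "Q \<xi> (Suc n) = 0" using nonneg[of "Suc n"] by simp
      have "Q \<xi> (Suc (Suc n)) = - d (Suc n) * Q \<xi> n / b (Suc n)" using 0 by simp
      also have "\<dots> < 0" using step d_pos[of "Suc n"] b_pos[of "Suc n"]
        by (simp add: divide_neg_pos)
      finally show False using nonneg[of "Suc (Suc n)"] by simp
    qed
  qed simp
  then have xi: "\<xi> \<in> G" by (simp add: G_def)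
  have "x \<le> \<xi> \<longleftrightarrow> x \<in> G" for x
    using upper[of x] lower[of x] xi by (cases "x = \<xi>") auto
  then have "\<forall>x. x \<le> \<xi> \<longleftrightarrow> (\<forall>n\<ge>1. Q x n > 0)" by (simp add: G_def)
  then show ?thesis using upper[OF ne] by blast
qed

end

section \<open>Spectral consequences of the drift condition, with \<open>\<kappa>\<close> in the
  role of \<open>lambda1\<close>\<close>

locale bd_rates_lyapunov = bd_rates_divergent +
  fixes C \<kappa> :: real and \<phi> :: "nat \<Rightarrow> real"
  assumes C_pos: "C > 0" and \<kappa>_gt: "\<kappa> > d 1" and \<phi>_nonneg: "\<phi> i \<ge> 0"
    and \<phi>_tendsto: "filterlim \<phi> at_top sequentially"
    and drift: "i \<ge> 1 \<Longrightarrow> L \<phi> i \<le> - \<kappa> * \<phi> i + C"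
begin

lemma \<kappa>_pos: "\<kappa> > 0"
  using d_pos[of 1] \<kappa>_gt by simp

text \<open>The function \<open>g\<close> below satisfies \<open>L g n = - 1 / \<pi> n\<close> for \<open>n \<le> K\<close> and \<open>L g n = 0\<close>
  beyond \<open>K\<close>; a multiple of it corrects \<open>\<phi>\<close> on the finite set where \<open>\<phi>\<close> fails to be a supersolution.\<close>

lemma ex_Q_pos: "\<exists>x>0. \<forall>n\<ge>1. Q x n > 0"
proof -
  have "eventually (\<lambda>n. \<phi> n \<ge> 2 * C / \<kappa>) sequentially"
    using \<phi>_tendsto by (simp add: filterlim_at_top)
  then obtain K0 where K0: "\<And>n. n \<ge> K0 \<Longrightarrow> \<phi> n \<ge> 2 * C / \<kappa>"
    by (auto simp: eventually_sequentially)
  define K where "K = max 1 K0"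
  have K: "K \<ge> 1" and K\<phi>: "\<And>n. n \<ge> K \<Longrightarrow> \<phi> n \<ge> 2 * C / \<kappa>" using K0 by (auto simp: K_def)
  \<comment> \<open>\<open>F\<close> prescribes the flux of \<open>g\<close>, losing one unit at
    each state up to \<open>K\<close> and zero afterwards; \<open>c\<close> holds the increments
    that produce it, with edge weight \<open>d 1\<close> between \<open>0\<close> and
    \<open>1\<close>.\<close>
  define F :: "nat \<Rightarrow> real" where "F n = real (K - n)" for n
  define c where "c k = (if k = 0 then F 0 / d 1 else F k / (\<pi> k * b k))" for k
  define g where "g n = (\<Sum>k<n. c k)" for n
  have c_nonneg: "c k \<ge> 0" for k
    unfolding c_def F_def using d_nonneg[of 1] b_nonneg[of k] pi_nonneg[of k] by simp
  have g_Suc: "g (Suc n) = g n + c n" for n by (simp add: g_def)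
  have g_nonneg: "g n \<ge> 0" for n unfolding g_def by (intro sum_nonneg c_nonneg)
  have g_le: "g n \<le> g K" for n
  proof (cases "n \<le> K")
    case True
    then show ?thesis unfolding g_def by (intro sum_mono2) (auto intro: c_nonneg)
  next
    case False
    then have "g n = g K" unfolding g_def
      by (intro sum.mono_neutral_right) (auto simp: c_def F_def)
    then show ?thesis by simp
  qed
  have g_pos: "g n > 0" if "n \<ge> 1" for n
  proof -
    have "0 < c 0" using K d_pos[of 1] by (simp add: c_def F_def)
    also have "c 0 \<le> g n" unfolding g_def using that by (intro member_le_sum) (auto intro: c_nonneg)
    finally show ?thesis .
  qed
  have Lg: "L g n = (F n - F (n - 1)) / \<pi> n" if n: "n \<ge> 1" for n
  proof -
    obtain m where m: "n = Suc m" using n by (cases n) auto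
    have 1: "b n * c n = F n / \<pi> n"
      using n b_pos[OF n] by (simp add: c_def)
    have 2: "d n * c m = F m / \<pi> n"
    proof (cases "m = 0")
      case True
      then show ?thesis using d_pos[of 1] by (simp add: c_def m pi_1)
    next
      case False
      then have "d n * c m = d n * F m / (\<pi> n * d n)" using pi_Suc[of m] by (simp add: c_def m)
      then show ?thesis using d_pos[OF n] by simp
    qed
    have "L g n = b n * c n - d n * c m" by (simp add: generator_def m g_Suc algebra_simps)
    then show ?thesis by (simp only: 1 2) (simp add: m diff_divide_distrib)
  qed
  \<comment> \<open>The sum dominates each \<open>\<pi> n\<close> with \<open>n \<le> K\<close>, so
    \<open>A / \<pi> n \<ge> C + 1\<close> there: the correction outweighs the constant
    \<open>C\<close> and leaves \<open>L u n \<le> - 1\<close>.\<close>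
  define A where "A = (C + 1) * (\<Sum>n=1..K. \<pi> n)"
  have A_nonneg: "A \<ge> 0" unfolding A_def using C_pos pi_nonneg by (simp add: sum_nonneg)
  have A_pos: "A > 0" unfolding A_def using C_pos pi_pos K by (auto intro!: mult_pos_pos sum_pos)
  define u where "u n = \<phi> n + A * g n" for n
  have u_nonneg: "u n \<ge> 0" for n unfolding u_def using \<phi>_nonneg g_nonneg A_nonneg by simp
  have u_pos: "u n > 0" if "n \<ge> 1" for n
    unfolding u_def using \<phi>_nonneg[of n] g_pos[OF that] A_pos by (simp add: add_nonneg_pos)
  define B where "B = (\<Sum>n\<le>K. \<phi> n) + A * g K"
  have u_le: "u n \<le> B" if "n \<le> K" for n
    unfolding u_def B_def using that A_nonneg g_le[of n]
    by (intro add_mono mult_left_mono member_le_sum) (auto intro: \<phi>_nonneg)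
  have B_nonneg: "B \<ge> 0" using u_le[of 0] u_nonneg[of 0] by simp
  \<comment> \<open>The bound \<open>1 / (B + 1)\<close> gives \<open>x * u n \<le> 1\<close> up to
    \<open>K\<close>. Beyond \<open>K\<close>, the other two bound \<open>x * \<phi> n\<close> by
    \<open>\<kappa> * \<phi> n / 4\<close> and \<open>x * A * g n\<close> by \<open>C / 2\<close>,
    which suffices as \<open>\<kappa> * \<phi> n \<ge> 2 * C\<close>.\<close>
  define x where "x = min (\<kappa> / 4) (min (C / (2 * (A * g K + 1))) (1 / (B + 1)))"
  have AgK: "A * g K \<ge> 0" using A_nonneg g_nonneg by simp
  have x_pos: "x > 0" unfolding x_def using \<kappa>_pos C_pos AgK B_nonneg by (simp add: add_nonneg_pos)
  have Lu: "L u n \<le> - x * u n" if n: "n \<ge> 1" for n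
  proof -
    have Lu_le: "L u n \<le> - \<kappa> * \<phi> n + C + A * L g n"
      unfolding u_def generator_add generator_scale using drift[OF n] by simp
    show ?thesis
    proof (cases "n \<le> K")
      case True
      have "F n - F (n - 1) = - 1" using n True by (simp add: F_def)
      then have "L g n = - 1 / \<pi> n" using Lg[OF n] by simp
      moreover have "A / \<pi> n \<ge> C + 1"
      proof -
        have "\<pi> n \<le> (\<Sum>n=1..K. \<pi> n)" using n True by (intro member_le_sum) (auto intro: pi_nonneg)
        then have "(C + 1) * \<pi> n \<le> A" unfolding A_def using C_pos by (intro mult_left_mono) auto
        then show ?thesis using pi_pos[of n] by (simp add: field_simps)
      qed
      ultimately have "L u n \<le> - 1"
      proof -
        have "0 \<le> \<kappa> * \<phi> n" using \<phi>_nonneg[of n] \<kappa>_pos by simp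
        moreover have "A * L g n = - (A / \<pi> n)" using \<open>L g n = - 1 / \<pi> n\<close> by simp
        ultimately show ?thesis using Lu_le \<open>A / \<pi> n \<ge> C + 1\<close> by linarith
      qed
      moreover have "x * u n \<le> 1"
      proof -
        have "x * u n \<le> (1 / (B + 1)) * B"
          using u_le[OF True] u_nonneg[of n] B_nonneg x_pos by (intro mult_mono) (auto simp: x_def)
        also have "\<dots> \<le> 1" using B_nonneg by (simp add: field_simps)
        finally show ?thesis .
      qed
      ultimately show ?thesis by simp
    next
      case False
      then have "L g n = 0" using Lg[OF n] by (simp add: F_def)
      moreover have "x * \<phi> n \<le> \<kappa> / 4 * \<phi> n"
        using \<phi>_nonneg[of n] unfolding x_def by (intro mult_right_mono min.cobounded1)
      moreover have "x * (A * g n) \<le> C / 2"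
      proof -
        have "x * (A * g n) \<le> C / (2 * (A * g K + 1)) * (A * g K)"
          using A_nonneg g_nonneg[of n] g_le[of n] C_pos AgK
          by (intro mult_mono mult_left_mono) (auto simp: x_def)
        also have "\<dots> \<le> C / 2" using AgK C_pos by (simp add: field_simps)
        finally show ?thesis .
      qed
      moreover have "\<kappa> * \<phi> n \<ge> 2 * C" using K\<phi>[of n] False \<kappa>_pos by (simp add: field_simps)
      ultimately show ?thesis using Lu_le C_pos unfolding u_def by (simp add: algebra_simps)
    qed
  qed
  show ?thesis
    using x_pos Q_pos_of_supersolution[of u x] u_nonneg u_pos Lu by blast
qed

section \<open>The critical level and its eigenfunction\<close>

definition "\<xi> = xi1 b d"

text \<open>The description in \<open>xi1\<close> is unique, since two numbers with the same set of
  lower bounds coincide; it lies above the positive level supplied by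
  \<open>ex_Q_pos\<close>.\<close>

lemma xi_pos: "\<xi> > 0" and xi_iff: "x \<le> \<xi> \<longleftrightarrow> (\<forall>n\<ge>1. Q x n > 0)"
proof -
  obtain x0 where x0: "x0 > 0" "\<forall>n\<ge>1. Q x0 n > 0" using ex_Q_pos by blast
  have "\<exists>z\<ge>x0. \<forall>x. x \<le> z \<longleftrightarrow> (\<forall>n\<ge>1. Q x n > 0)"
    by (rule xi1_exists) (use x0 in auto)
  then obtain z where z: "z \<ge> x0" "\<forall>x. x \<le> z \<longleftrightarrow> (\<forall>n\<ge>1. Q x n > 0)"
    by (elim exE conjE)
  have xi: "\<xi> = z" unfolding \<xi>_def xi1_def
  proof (rule the_equality)
    have "0 \<le> z" using z(1) x0(1) by linarith
    then show "0 \<le> z \<and> (\<forall>x. x \<le> z \<longleftrightarrow> (\<forall>n\<ge>1. Q x n > 0))" using z(2) by (rule conjI)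
    fix y assume y: "0 \<le> y \<and> (\<forall>x. x \<le> y \<longleftrightarrow> (\<forall>n\<ge>1. Q x n > 0))"
    have "x \<le> y \<longleftrightarrow> x \<le> z" for x
      using conjunct2[OF y, THEN spec, of x] z(2)[THEN spec, of x] by (rule trans[OF _ sym])
    from this[of y] this[of z] show "y = z" by simp
  qed
  show "\<xi> > 0" using z(1) x0(1) xi by linarith
  show "x \<le> \<xi> \<longleftrightarrow> (\<forall>n\<ge>1. Q x n > 0)" unfolding xi using z(2) by (rule spec)
qed

abbreviation "q \<equiv> Q \<xi>"

lemma q_pos: "n \<ge> 1 \<Longrightarrow> q n > 0"
  using xi_iff[of \<xi>] by simp

lemma q_nonneg: "q n \<ge> 0"
  using q_pos[of n] by (cases n) auto

lemma q_mono: "mono q"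
  using Q_mono q_pos xi_pos by simp

lemma xi_le: "\<xi> \<le> d 1"
  using Q_pos_imp_le q_pos by simp

text \<open>By \<open>flux_eq\<close>, nonnegativity of the flux bounds the partial sums by
  \<open>d 1 / \<xi>\<close>.\<close>

lemma summable_pi_q: "summable (\<lambda>n. \<pi> n * q n)"
proof (rule bounded_imp_summable)
  show "\<pi> n * q n \<ge> 0" for n using pi_nonneg q_nonneg by simp
  show "(\<Sum>k\<le>n. \<pi> k * q k) \<le> d 1 / \<xi>" for n
  proof (cases "n = 0")
    case False
    then have "{..n} = insert 0 {1..n}" by auto
    then have "(\<Sum>k\<le>n. \<pi> k * q k) = (\<Sum>k=1..n. \<pi> k * q k)" by simp
    moreover have "d 1 - \<xi> * (\<Sum>k=1..n. \<pi> k * q k) \<ge> 0"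
      using flux_nonneg[of \<xi> n] flux_eq[of n \<xi>] q_pos xi_pos False by simp
    ultimately show ?thesis using xi_pos by (simp add: field_simps)
  qed (use xi_pos d_nonneg[of 1] in simp)
qed

text \<open>Continuity handles finitely many polynomials at once; for each fixed
  \<open>x > \<xi>\<close>, some later polynomial fails to be positive.\<close>

lemma eventually_Q_pos: "\<forall>\<^sub>F x in at_right \<xi>. \<forall>n\<in>{1..m}. Q x n > 0"
proof (intro eventually_ball_finite ballI)
  fix n assume "n \<in> {1..m}"
  then show "\<forall>\<^sub>F x in at_right \<xi>. Q x n > 0"
    using order_tendstoD(1)[OF continuous_bd_Q[unfolded isCont_def]] q_pos[of n]
    by (simp add: eventually_at_split)
qed simp

text \<open>Otherwise the Wronskian would stay positive at some level slightly above \<open>\<xi>\<close>, where \<open>\<phi>\<close> is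
  still a supersolution near infinity, contradicting the maximality of \<open>\<xi>\<close>.\<close>

lemma wronskian_nonpos:
  assumes K: "K \<ge> 1" "\<And>n. n \<ge> K \<Longrightarrow> \<phi> n > 0" "\<And>n. n \<ge> K \<Longrightarrow> L \<phi> n \<le> - \<mu> * \<phi> n"
    and \<mu>: "\<mu> > \<xi>" and m: "m \<ge> K"
  shows "W q \<phi> m \<le> 0"
proof (rule ccontr)
  assume "\<not> ?thesis"
  then have Wm: "W q \<phi> m > 0" by simp
  have W_cont: "isCont (\<lambda>x. W (Q x) \<phi> m) \<xi>"
    unfolding bd_wronskian_def using continuous_bd_Q by (intro continuous_intros)
  have "\<forall>\<^sub>F x in at_right \<xi>. W (Q x) \<phi> m > 0"
    using order_tendstoD(1)[OF W_cont[unfolded isCont_def] Wm]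
    by (simp add: eventually_at_split)
  moreover note eventually_Q_pos[of m]
  moreover have "\<forall>\<^sub>F x in at_right \<xi>. x \<in> {\<xi><..<\<mu>}"
    using \<mu> by (rule eventually_at_right_real)
  ultimately have ev: "\<forall>\<^sub>F x in at_right \<xi>. W (Q x) \<phi> m > 0 \<and> (\<forall>n\<in>{1..m}. Q x n > 0) \<and> x \<in> {\<xi><..<\<mu>}"
    by eventually_elim simp
  then obtain x where x: "W (Q x) \<phi> m > 0" "\<forall>n\<in>{1..m}. Q x n > 0" "x > \<xi>" "x < \<mu>"
    using eventually_happens[OF ev] by auto
  have "Q x n > 0" if "n \<ge> 1" for n
  proof (cases "n \<le> m")
    case True
    then show ?thesis using x that by simp
  next
    case False
    show ?thesis
    proof (rule Q_pos_from[of m x \<phi> n])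
      fix n assume "n > m"
      then have "x * \<phi> n \<le> \<mu> * \<phi> n"
        using x(4) \<phi>_nonneg by (intro mult_right_mono) auto
      then show "L \<phi> n \<le> - x * \<phi> n"
        using K(3)[of n] m \<open>n > m\<close> by simp
    qed (use False K m x in auto)
  qed
  then show False using xi_iff[of x] x(3) by simp
qed

text \<open>The Wronskian of \<open>q\<close> and \<open>\<phi>\<close> stays nonpositive beyond
  \<open>K\<close>, so \<open>q / \<phi>\<close> does not increase there. The Wronskian also grows
  by at least \<open>(\<mu> - \<xi>) * \<pi> n * q n * \<phi> n\<close> at each step, so these terms
  have a finite sum. Together they bound the sum of \<open>\<pi> n * q n * q n\<close>.\<close>

lemma summable_pi_q_sq: "summable (\<lambda>n. \<pi> n * (q n)\<^sup>2)"
proof -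
  \<comment> \<open>The gap below \<open>\<kappa>\<close> absorbs \<open>C\<close> where
    \<open>\<phi>\<close> is large; the gap above \<open>\<xi>\<close> makes the Wronskian
    grow.\<close>
  define \<mu> where "\<mu> = (\<kappa> + d 1) / 2"
  have \<mu>: "\<mu> > \<xi>" "\<mu> < \<kappa>" using \<kappa>_gt xi_le by (auto simp: \<mu>_def)
  have "eventually (\<lambda>n. \<phi> n \<ge> C / (\<kappa> - \<mu>)) sequentially"
    using \<phi>_tendsto by (simp add: filterlim_at_top)
  then obtain K0 where K0: "\<And>n. n \<ge> K0 \<Longrightarrow> \<phi> n \<ge> C / (\<kappa> - \<mu>)"
    by (auto simp: eventually_sequentially)
  define K where "K = max 1 K0"
  have K: "K \<ge> 1" by (simp add: K_def)
  have \<phi>_ge: "\<phi> n \<ge> C / (\<kappa> - \<mu>)" if "n \<ge> K" for n using K0[of n] that by (simp add: K_def)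
  have \<phi>_pos: "\<phi> n > 0" if "n \<ge> K" for n
    using \<phi>_ge[OF that] C_pos \<mu> by (meson diff_gt_0_iff_gt divide_pos_pos less_le_trans)
  have L\<phi>: "L \<phi> n \<le> - \<mu> * \<phi> n" if "n \<ge> K" for n
    using drift[of n] \<phi>_ge[OF that] \<mu> K that by (simp add: field_simps)
  have W_nonpos: "W q \<phi> m \<le> 0" if "m \<ge> K" for m
    using wronskian_nonpos[OF K \<phi>_pos L\<phi> \<mu>(1) that] by simp
  have W_sum: "W q \<phi> n \<ge> W q \<phi> K + (\<mu> - \<xi>) * (\<Sum>k=Suc K..n. \<pi> k * q k * \<phi> k)" if "n \<ge> K" for n
    using that
  proof (induction n rule: dec_induct)
    case (step n)
    have "q (Suc n) * L \<phi> (Suc n) \<le> q (Suc n) * (- \<mu> * \<phi> (Suc n))"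
      using L\<phi>[of "Suc n"] step.hyps q_nonneg by (intro mult_left_mono) auto
    then have "\<phi> (Suc n) * L q (Suc n) - q (Suc n) * L \<phi> (Suc n) \<ge> (\<mu> - \<xi>) * (q (Suc n) * \<phi> (Suc n))"
      unfolding generator_Q[of "Suc n" \<xi>, simplified] by (simp add: algebra_simps)
    then have "\<pi> (Suc n) * (\<phi> (Suc n) * L q (Suc n) - q (Suc n) * L \<phi> (Suc n))
        \<ge> \<pi> (Suc n) * ((\<mu> - \<xi>) * (q (Suc n) * \<phi> (Suc n)))"
      using pi_nonneg by (intro mult_left_mono)
    moreover have "n \<ge> 1" using step.hyps K by simp
    ultimately show ?case
      using lagrange_identity_Suc[of n q \<phi>] step.IH step.hyps
      by (simp add: algebra_simps)
  qed simp
  define c where "c = q K / \<phi> K"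
  have q_le: "q n \<le> c * \<phi> n" if "n \<ge> K" for n
    using that
  proof (induction n rule: dec_induct)
    case base
    then show ?case using \<phi>_pos[of K] by (simp add: c_def)
  next
    case (step n)
    have n1: "n \<ge> 1" using step.hyps K by simp
    have "q (Suc n) * \<phi> n \<le> q n * \<phi> (Suc n)"
      using W_nonpos[of n] step.hyps
        mult_le_cancel_left_pos[OF mult_pos_pos[OF pi_pos[of n] b_pos[OF n1]], of _ 0]
      unfolding bd_wronskian_def by simp
    also have "q n * \<phi> (Suc n) \<le> c * \<phi> n * \<phi> (Suc n)"
      using step.IH \<phi>_nonneg by (intro mult_right_mono)
    finally have "q (Suc n) * \<phi> n \<le> (c * \<phi> (Suc n)) * \<phi> n" by (simp add: algebra_simps)
    then show ?case using \<phi>_pos[of n] step.hyps by simp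
  qed
  have c_nonneg: "c \<ge> 0" unfolding c_def using q_nonneg \<phi>_nonneg by simp
  have bound: "(\<Sum>k=Suc K..n. \<pi> k * q k * \<phi> k) \<le> - W q \<phi> K / (\<mu> - \<xi>)" if "n \<ge> K" for n
    using W_sum[OF that] W_nonpos[OF that] \<mu> by (simp add: field_simps)
  show ?thesis
  proof (rule bounded_imp_summable)
    show "\<pi> n * (q n)\<^sup>2 \<ge> 0" for n using pi_nonneg by simp
    fix n
    \<comment> \<open>Enlarging the range to \<open>max n K\<close> lets the sum be split at
      \<open>K\<close> even when \<open>n < K\<close>.\<close>
    have "(\<Sum>k\<le>n. \<pi> k * (q k)\<^sup>2) \<le> (\<Sum>k\<in>{..K} \<union> {Suc K..max n K}. \<pi> k * (q k)\<^sup>2)"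
      by (intro sum_mono2) (auto simp: pi_nonneg)
    also have "\<dots> = (\<Sum>k\<le>K. \<pi> k * (q k)\<^sup>2) + (\<Sum>k=Suc K..max n K. \<pi> k * (q k)\<^sup>2)"
      by (intro sum.union_disjoint) auto
    also have "(\<Sum>k=Suc K..max n K. \<pi> k * (q k)\<^sup>2) \<le> (\<Sum>k=Suc K..max n K. c * (\<pi> k * q k * \<phi> k))"
    proof (rule sum_mono)
      fix k assume "k \<in> {Suc K..max n K}"
      then have "\<pi> k * q k * q k \<le> \<pi> k * q k * (c * \<phi> k)"
        using q_le[of k] pi_nonneg q_nonneg by (intro mult_left_mono) auto
      then show "\<pi> k * (q k)\<^sup>2 \<le> c * (\<pi> k * q k * \<phi> k)" by (simp add: power2_eq_square algebra_simps)
    qed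
    also have "\<dots> \<le> c * (- W q \<phi> K / (\<mu> - \<xi>))"
      unfolding sum_distrib_left[symmetric] using bound[of "max n K"] c_nonneg by (intro mult_left_mono) auto
    finally show "(\<Sum>k\<le>n. \<pi> k * (q k)\<^sup>2) \<le> (\<Sum>k\<le>K. \<pi> k * (q k)\<^sup>2) + c * (- W q \<phi> K / (\<mu> - \<xi>))"
      by simp
  qed
qed

end

section \<open>Real analysis\<close>

lemma filterlim_abs_diff_at_right_0:
  "filterlim (\<lambda>y::real. \<bar>y - t\<bar>) (at_right 0) (at t within S)"
  unfolding filterlim_at
proof
  show "\<forall>\<^sub>F y in at t within S. \<bar>y - t\<bar> \<in> {0<..} \<and> \<bar>y - t\<bar> \<noteq> 0"
    by (auto simp: eventually_at_filter)
  show "((\<lambda>y. \<bar>y - t\<bar>) \<longlongrightarrow> 0) (at t within S)"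
    by (auto intro!: tendsto_eq_intros)
qed

text \<open>Since \<open>\<eta>\<close> does not depend on the base point, an increment to the left
  of \<open>t\<close> can be estimated from its left endpoint.\<close>

lemma continuous_on_of_right_modulus:
  fixes g \<eta> :: "real \<Rightarrow> real"
  assumes g: "\<And>t h. 0 \<le> t \<Longrightarrow> 0 < h \<Longrightarrow> \<bar>g (t + h) - g t\<bar> \<le> \<eta> h"
    and \<eta>: "(\<eta> \<longlongrightarrow> 0) (at_right 0)"
  shows "continuous_on {0..} g"
  unfolding continuous_on_def
proof
  fix t :: real assume t: "t \<in> {0..}"
  have "((\<lambda>y. g y - g t) \<longlongrightarrow> 0) (at t within {0..})"
  proof (rule Lim_null_comparison)
    show "((\<lambda>y. \<eta> \<bar>y - t\<bar>) \<longlongrightarrow> 0) (at t within {0..})"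
      using \<eta> filterlim_abs_diff_at_right_0 by (rule filterlim_compose)
    have "\<bar>g y - g t\<bar> \<le> \<eta> \<bar>y - t\<bar>" if "y \<noteq> t" "y \<ge> 0" for y
      using g[of t "y - t"] g[of y "t - y"] that t by (cases "y < t") auto
    then show "\<forall>\<^sub>F y in at t within {0..}. norm (g y - g t) \<le> \<eta> \<bar>y - t\<bar>"
      by (auto simp: eventually_at_filter)
  qed
  then show "(g \<longlongrightarrow> g t) (at t within {0..})" by (simp add: LIM_zero_iff)
qed

lemma has_real_derivative_of_uniform_right_derivative:
  fixes g G \<eta> :: "real \<Rightarrow> real"
  assumes g: "\<And>t h. 0 \<le> t \<Longrightarrow> 0 < h \<Longrightarrow> \<bar>g (t + h) - g t - h * G t\<bar> \<le> h * \<eta> h"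
    and \<eta>: "(\<eta> \<longlongrightarrow> 0) (at_right 0)" and G: "continuous_on {0..} G" and t: "0 \<le> t"
  shows "(g has_real_derivative G t) (at t within {0..})"
  unfolding has_field_derivative_iff
proof -
  have "((\<lambda>y. (g y - g t) / (y - t) - G t) \<longlongrightarrow> 0) (at t within {0..})"
  proof (rule Lim_null_comparison)
    \<comment> \<open>The increment between \<open>y\<close> and \<open>t\<close> starts at
      \<open>min y t\<close>, so one estimate covers both sides. On the left, continuity of
      \<open>G\<close> moves the slope from \<open>y\<close> to \<open>t\<close>.\<close>
    have "continuous_on {0..} (\<lambda>y. G (min y t))"
      by (intro continuous_on_compose2[OF G]) (use t in \<open>auto intro!: continuous_intros\<close>)
    then have "((\<lambda>y. G (min y t)) \<longlongrightarrow> G (min t t)) (at t within {0..})"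
      using t unfolding continuous_on_def by (metis atLeast_iff)
    then have "((\<lambda>y. \<bar>G (min y t) - G t\<bar>) \<longlongrightarrow> 0) (at t within {0..})"
      by (auto intro!: tendsto_eq_intros)
    moreover have "((\<lambda>y. \<eta> \<bar>y - t\<bar>) \<longlongrightarrow> 0) (at t within {0..})"
      using \<eta> filterlim_abs_diff_at_right_0 by (rule filterlim_compose)
    ultimately show "((\<lambda>y. \<eta> \<bar>y - t\<bar> + \<bar>G (min y t) - G t\<bar>) \<longlongrightarrow> 0) (at t within {0..})"
      by (intro tendsto_add_zero)
    have "\<bar>(g y - g t) / (y - t) - G t\<bar> \<le> \<eta> \<bar>y - t\<bar> + \<bar>G (min y t) - G t\<bar>"
      if y: "y \<noteq> t" "y \<ge> 0" for y
    proof -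
      define h where "h = \<bar>y - t\<bar>"
      have h: "h > 0" using y by (simp add: h_def)
      define D where "D = (g (min y t + h) - g (min y t)) / h"
      have "D - G (min y t) = (g (min y t + h) - g (min y t) - h * G (min y t)) / h"
        using h unfolding D_def by (simp add: field_simps)
      then have "\<bar>D - G (min y t)\<bar> = \<bar>g (min y t + h) - g (min y t) - h * G (min y t)\<bar> / h"
        using h by (simp add: abs_divide)
      also have "\<dots> \<le> \<eta> h" using g[of "min y t" h] y(2) t h by (simp add: field_simps)
      finally have "\<bar>D - G t\<bar> \<le> \<eta> h + \<bar>G (min y t) - G t\<bar>" by linarith
      moreover have "D = (g y - g t) / (y - t)"
        using y unfolding D_def h_def by (cases "y < t") (auto simp: field_simps)
      ultimately show ?thesis by (simp add: h_def)
    qed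
    then show "\<forall>\<^sub>F y in at t within {0..}. norm ((g y - g t) / (y - t) - G t) \<le> \<eta> \<bar>y - t\<bar> + \<bar>G (min y t) - G t\<bar>"
      by (auto simp: eventually_at_filter)
  qed
  then show "((\<lambda>y. (g y - g t) / (y - t)) \<longlongrightarrow> G t) (at t within {0..})" by (simp add: LIM_zero_iff)
qed

text \<open>The index set stands in for a matrix type because the size of the matrix has to vary.\<close>

lemma reversible_matrix_exponential:
  fixes a :: "'a \<Rightarrow> 'a \<Rightarrow> real" and w :: "'a \<Rightarrow> real"
  assumes I: "finite I" and rev: "\<And>i j. i \<in> I \<Longrightarrow> j \<in> I \<Longrightarrow> w i * a i j = w j * a j i"
  obtains e where
    "\<And>t i j. i \<in> I \<Longrightarrow> j \<in> I \<Longrightarrow> ((\<lambda>t. e t i j) has_real_derivative (\<Sum>k\<in>I. a i k * e t k j)) (at t)"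
    "\<And>i j. e 0 i j = (if i = j then 1 else 0)"
    "\<And>t i j. i \<in> I \<Longrightarrow> j \<in> I \<Longrightarrow> w i * e t i j = w j * e t j i"
proof -
  \<comment> \<open>\<open>m n\<close> is the \<open>n\<close>-th power of the matrix, built by
    multiplication from the left.\<close>
  define m where "m = rec_nat (\<lambda>i j. if i = j then 1 else 0 :: real) (\<lambda>_ m i j. \<Sum>k\<in>I. a i k * m k j)"
  have m_0: "m 0 i j = (if i = j then 1 else 0)" for i j by (simp add: m_def)
  have m_Suc: "m (Suc n) i j = (\<Sum>k\<in>I. a i k * m n k j)" for n i j by (simp add: m_def)
  \<comment> \<open>Transposing a product reverses its factors, so the induction for
    \<open>m_rev\<close> also needs the powers built from the right.\<close>
  have m_Suc': "m (Suc n) i j = (\<Sum>k\<in>I. m n i k * a k j)" if "i \<in> I" "j \<in> I" for n i j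
    using that
  proof (induction n arbitrary: i j)
    case 0
    then show ?case using I
      by (simp add: m_Suc m_0 if_distrib[of "\<lambda>x. _ * x"] if_distrib[of "\<lambda>x. x * _"] cong: if_cong)
  next
    case (Suc n)
    have "m (Suc (Suc n)) i j = (\<Sum>k\<in>I. a i k * (\<Sum>l\<in>I. m n k l * a l j))"
      unfolding m_Suc[of "Suc n"] using Suc by simp
    also have "\<dots> = (\<Sum>l\<in>I. (\<Sum>k\<in>I. a i k * m n k l) * a l j)"
      unfolding sum_distrib_left sum_distrib_right by (subst sum.swap) (simp add: mult.assoc)
    finally show ?case by (simp add: m_Suc)
  qed
  have m_rev: "w i * m n i j = w j * m n j i" if "i \<in> I" "j \<in> I" for n i j
    using that
  proof (induction n arbitrary: i j)
    case 0
    then show ?case by (simp add: m_0)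
  next
    case (Suc n)
    have "w i * m (Suc n) i j = (\<Sum>k\<in>I. w i * a i k * m n k j)"
      by (simp add: m_Suc sum_distrib_left mult.assoc)
    also have "\<dots> = (\<Sum>k\<in>I. w j * (m n j k * a k i))"
    proof (rule sum.cong[OF refl])
      fix k assume k: "k \<in> I"
      have "w i * a i k * m n k j = a k i * (w k * m n k j)" using rev[OF Suc.prems(1) k] by simp
      then show "w i * a i k * m n k j = w j * (m n j k * a k i)"
        using Suc.IH[OF k Suc.prems(2)] by simp
    qed
    finally show ?case using m_Suc'[OF Suc.prems(2,1), of n] by (simp add: sum_distrib_left)
  qed
  \<comment> \<open>\<open>M\<close> dominates every row sum of absolute values, so the exponential
    series converges for every \<open>t\<close>.\<close>
  define M where "M = (\<Sum>i\<in>I. \<Sum>k\<in>I. \<bar>a i k\<bar>)"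
  have m_le: "\<bar>m n i j\<bar> \<le> M ^ n" if "i \<in> I" for n i j
    using that
  proof (induction n arbitrary: i)
    case (Suc n)
    have "\<bar>m (Suc n) i j\<bar> \<le> (\<Sum>k\<in>I. \<bar>a i k\<bar> * \<bar>m n k j\<bar>)"
      unfolding m_Suc abs_mult[symmetric] by (rule sum_abs)
    also have "\<dots> \<le> (\<Sum>k\<in>I. \<bar>a i k\<bar> * M ^ n)"
      using Suc.IH by (intro sum_mono mult_left_mono) auto
    also have "\<dots> = (\<Sum>k\<in>I. \<bar>a i k\<bar>) * M ^ n" by (simp add: sum_distrib_right)
    also have "\<dots> \<le> M * M ^ n"
    proof (rule mult_right_mono)
      show "(\<Sum>k\<in>I. \<bar>a i k\<bar>) \<le> M" unfolding M_def
        using Suc.prems I by (intro member_le_sum) (auto intro: sum_nonneg)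
      show "0 \<le> M ^ n" unfolding M_def by (simp add: sum_nonneg)
    qed
    finally show ?case by simp
  qed (simp add: m_0)
  define c where "c i j n = m n i j / fact n" for i j n
  have summable_c: "summable (\<lambda>n. c i j n * t ^ n)" if "i \<in> I" for i j and t :: real
  proof (rule summable_comparison_test')
    show "summable (\<lambda>n. inverse (fact n) * (M * \<bar>t\<bar>) ^ n)" by (rule summable_exp)
    fix n :: nat
    show "norm (c i j n * t ^ n) \<le> inverse (fact n) * (M * \<bar>t\<bar>) ^ n"
      using mult_right_mono[OF m_le[OF that, of n j], of "\<bar>t\<bar> ^ n"]
      by (simp add: c_def abs_mult power_abs power_mult_distrib field_simps)
  qed
  define e where "e t i j = (\<Sum>n. c i j n * t ^ n)" for t i j
  show ?thesis
  proof (rule that)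
    show "e 0 i j = (if i = j then 1 else 0)" for i j
      unfolding e_def powser_zero by (simp add: c_def m_0)
    show "w i * e t i j = w j * e t j i" if "i \<in> I" "j \<in> I" for t i j
      unfolding e_def suminf_mult[OF summable_c[OF that(1)], symmetric]
        suminf_mult[OF summable_c[OF that(2)], symmetric]
      using m_rev[OF that] by (simp add: c_def mult.assoc[symmetric])
    show "((\<lambda>t. e t i j) has_real_derivative (\<Sum>k\<in>I. a i k * e t k j)) (at t)"
      if "i \<in> I" "j \<in> I" for t i j
    proof -
      have "((\<lambda>t. e t i j) has_real_derivative (\<Sum>n. diffs (c i j) n * t ^ n)) (at t)"
        unfolding e_def by (rule termdiffs_strong_converges_everywhere) (rule summable_c[OF that(1)])
      also have "(\<lambda>n. diffs (c i j) n * t ^ n) = (\<lambda>n. \<Sum>k\<in>I. a i k * (c k j n * t ^ n))"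
      proof
        fix n
        have "diffs (c i j) n = m (Suc n) i j / fact n"
          by (simp add: diffs_def c_def field_simps del: of_nat_Suc)
        then show "diffs (c i j) n * t ^ n = (\<Sum>k\<in>I. a i k * (c k j n * t ^ n))"
          by (simp add: m_Suc c_def sum_distrib_right sum_divide_distrib mult.assoc)
      qed
      also have "(\<Sum>n. \<Sum>k\<in>I. a i k * (c k j n * t ^ n)) = (\<Sum>k\<in>I. a i k * e t k j)"
        unfolding e_def
        by (subst suminf_sum) (auto intro!: summable_mult summable_c sum.cong suminf_mult)
      finally show ?thesis .
    qed
  qed
qed

text \<open>If \<open>f\<close> increased over one step, midpoint convexity would repeat at least
  that increase over every later step of the same length and break the upper bound. So
  \<open>f\<close> is nonincreasing and converges to its infimum.\<close>

lemma tendsto_at_top_of_bounded_midpoint_convex: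
  fixes f :: "real \<Rightarrow> real"
  assumes conv: "\<And>s t. 0 \<le> s \<Longrightarrow> 0 \<le> t \<Longrightarrow> f (s + t) \<le> (f (2 * s) + f (2 * t)) / 2"
    and upper: "\<And>t. 0 \<le> t \<Longrightarrow> f t \<le> B" and lower: "\<And>t. 0 \<le> t \<Longrightarrow> c \<le> f t"
  obtains l where "c \<le> l" "(f \<longlongrightarrow> l) at_top"
proof -
  have anti: "f t \<le> f s" if st: "0 \<le> s" "s \<le> t" for s t
  proof (rule ccontr)
    define h where "h = t - s"
    define \<delta> where "\<delta> = f t - f s"
    assume "\<not> ?thesis"
    then have \<delta>: "\<delta> > 0" by (simp add: \<delta>_def)
    have inc: "f (s + real (Suc n) * h) - f (s + real n * h) \<ge> \<delta>" for n
    proof (induction n)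
      case (Suc n)
      define r where "r = s + real n * h"
      have r: "r \<ge> 0" "h \<ge> 0" using st by (auto simp: r_def h_def)
      have "f (r / 2 + (r + 2 * h) / 2) \<le> (f (2 * (r / 2)) + f (2 * ((r + 2 * h) / 2))) / 2"
        using r by (intro conv) auto
      then have "f (r + h) \<le> (f r + f (r + 2 * h)) / 2" by (simp add: add_divide_distrib)
      moreover have "s + real (Suc n) * h = r + h" "s + real (Suc (Suc n)) * h = r + 2 * h"
        by (auto simp: r_def algebra_simps)
      ultimately show ?case using Suc unfolding r_def[symmetric] by simp
    qed (simp add: \<delta>_def h_def)
    have "f (s + real n * h) \<ge> f s + real n * \<delta>" for n
    proof (induction n)
      case (Suc n)
      then show ?case using inc[of n] by (simp add: algebra_simps)
    qed simp
    moreover obtain n where "real n * \<delta> > B - f s" using \<delta> reals_Archimedean3 by blast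
    ultimately have "f (s + real n * h) > B" by (smt (verit))
    moreover have "s + real n * h \<ge> 0" using st by (simp add: h_def)
    ultimately show False using upper by (meson not_le)
  qed
  define l where "l = (INF t\<in>{0..}. f t)"
  have bdd: "bdd_below (f ` {0..})" using lower by (auto simp: bdd_below_def)
  have l_le: "l \<le> f t" if "t \<ge> 0" for t unfolding l_def using bdd that by (intro cINF_lower) auto
  have "(f \<longlongrightarrow> l) at_top"
  proof (rule order_tendstoI)
    fix a assume "a < l"
    then have "\<forall>t\<ge>0. a < f t" using l_le by (meson less_le_trans)
    then show "\<forall>\<^sub>F t in at_top. a < f t" by (auto simp: eventually_at_top_linorder)
  next
    fix a assume "l < a"
    then obtain s where s: "s \<ge> 0" "f s < a"
      unfolding l_def using bdd by (auto simp: cINF_less_iff)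
    then have "\<forall>t\<ge>s. f t < a" using anti by (meson le_less_trans)
    then show "\<forall>\<^sub>F t in at_top. f t < a" by (auto simp: eventually_at_top_linorder)
  qed
  moreover have "c \<le> l" unfolding l_def using lower by (intro cINF_greatest) auto
  ultimately show ?thesis using that by blast
qed

section \<open>Maximum principles\<close>

context bd_rates
begin

lemma generator_sum: "L (\<lambda>i. \<Sum>k\<in>S. u k i) i = (\<Sum>k\<in>S. L (u k) i)"
  by (simp add: generator_def sum_subtractf sum.distrib flip: sum_distrib_left)

text \<open>This links finite matrix sums to the generator: a state outside \<open>I\<close> is
  either unreachable in one jump or carries the value zero.\<close>

lemma sum_rate_eq_generator:
  assumes "finite I" "i \<ge> 1" "i \<in> I" "\<And>k. k \<notin> I \<Longrightarrow> bd_rate b d i k = 0 \<or> u k = 0"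
  shows "(\<Sum>k\<in>I. bd_rate b d i k * u k) = L u i"
proof -
  have "(\<Sum>k\<in>I. bd_rate b d i k * u k) = (\<Sum>k\<in>I \<union> {i - 1, i, i + 1}. bd_rate b d i k * u k)"
    using assms by (intro sum.mono_neutral_left) auto
  also have "\<dots> = (\<Sum>k\<in>{i - 1, i, i + 1}. bd_rate b d i k * u k)"
    using assms by (intro sum.mono_neutral_right) (auto simp: bd_rate_def)
  also have "\<dots> = L u i"
    using assms(2) by (cases i) (auto simp: bd_rate_def generator_def algebra_simps)
  finally show ?thesis .
qed

text \<open>Detailed balance, on positive states only: between \<open>0\<close> and \<open>1\<close>
  just the downward rate is positive.\<close>

lemma pi_rate_symmetric:
  assumes "i \<ge> 1" "j \<ge> 1"
  shows "\<pi> i * bd_rate b d i j = \<pi> j * bd_rate b d j i"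
  using pi_Suc[OF assms(1)] pi_Suc[OF assms(2)] by (auto simp: bd_rate_def)

text \<open>At a positive maximum of \<open>w t i - \<epsilon> t\<close> over \<open>[0, T] \<times> {1..N}\<close>, the time derivative would be at
  most \<open>- \<epsilon>\<close>, although it is nonnegative from the left.\<close>

lemma maximum_principle:
  fixes w w' :: "real \<Rightarrow> nat \<Rightarrow> real"
  assumes deriv: "\<And>t i. 0 \<le> t \<Longrightarrow> i \<in> {1..N} \<Longrightarrow>
      ((\<lambda>s. w s i) has_real_derivative w' t i) (at t within {0..})"
    and le: "\<And>t i. 0 \<le> t \<Longrightarrow> i \<in> {1..N} \<Longrightarrow> w' t i \<le> L (w t) i"
    and init: "\<And>i. i \<in> {1..N} \<Longrightarrow> w 0 i \<le> 0"
    and bdry: "\<And>t. 0 \<le> t \<Longrightarrow> w t 0 \<le> 0" "\<And>t. 0 \<le> t \<Longrightarrow> w t (Suc N) \<le> 0"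
    and T: "0 \<le> T" and i: "i \<in> {1..N}"
  shows "w T i \<le> 0"
proof (rule field_le_epsilon)
  fix \<epsilon>' :: real assume "\<epsilon>' > 0"
  define \<epsilon> where "\<epsilon> = \<epsilon>' / (T + 1)"
  have \<epsilon>: "\<epsilon> > 0" using \<open>\<epsilon>' > 0\<close> T by (simp add: \<epsilon>_def)
  \<comment> \<open>Subtracting \<open>\<epsilon> * t\<close> makes the differential inequality
    strict.\<close>
  define z where "z t k = w t k - \<epsilon> * t" for t k
  have z_deriv: "((\<lambda>s. z s k) has_real_derivative w' t k - \<epsilon>) (at t within {0..})"
    if "0 \<le> t" "k \<in> {1..N}" for t k
    unfolding z_def using deriv[OF that] by (auto intro!: derivative_eq_intros)
  have "\<exists>t\<in>{0..T}. \<forall>s\<in>{0..T}. z s k \<le> z t k" if "k \<in> {1..N}" for k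
  proof (rule continuous_attains_sup)
    have "continuous_on {0..} (\<lambda>s. z s k)"
      using z_deriv[OF _ that] by (intro DERIV_continuous_on) auto
    then show "continuous_on {0..T} (\<lambda>s. z s k)" by (rule continuous_on_subset) auto
  qed (use T in auto)
  then obtain \<tau> where \<tau>: "\<And>k. k \<in> {1..N} \<Longrightarrow> \<tau> k \<in> {0..T}"
    "\<And>k s. k \<in> {1..N} \<Longrightarrow> s \<in> {0..T} \<Longrightarrow> z s k \<le> z (\<tau> k) k" by metis
  obtain j where j: "j \<in> {1..N}" "\<And>k. k \<in> {1..N} \<Longrightarrow> z (\<tau> k) k \<le> z (\<tau> j) j"
  proof -
    have "Max ((\<lambda>k. z (\<tau> k) k) ` {1..N}) \<in> (\<lambda>k. z (\<tau> k) k) ` {1..N}"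
      using i by (intro Max_in) auto
    then obtain j where "j \<in> {1..N}" "z (\<tau> j) j = Max ((\<lambda>k. z (\<tau> k) k) ` {1..N})" by auto
    then show ?thesis using that[of j] by simp
  qed
  define t where "t = \<tau> j"
  have t: "t \<in> {0..T}" using \<tau>(1)[OF j(1)] by (simp add: t_def)
  have max: "z s k \<le> z t j" if "k \<in> {1..N}" "s \<in> {0..T}" for s k
    using \<tau>(2)[OF that] j(2)[OF that(1)] by (simp add: t_def)
  have "z t j \<le> 0"
  proof (rule ccontr)
    assume "\<not> ?thesis"
    then have pos: "z t j > 0" by simp
    have "t \<noteq> 0" using pos init[OF j(1)] by (auto simp: z_def)
    then have t0: "t > 0" using t by simp
    \<comment> \<open>The boundary values of \<open>z\<close> are nonpositive, so a positive maximum
      over the interior also dominates both neighbours.\<close>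
    have nbr: "z t k \<le> z t j" if "k \<le> Suc N" for k
    proof -
      have "\<epsilon> * t \<ge> 0" using \<epsilon> t by simp
      then have "k \<in> {1..N} \<or> z t k \<le> 0"
        using that bdry[of t] t by (cases "k = 0 \<or> k = Suc N") (auto simp: z_def)
      then show ?thesis using max[of k t] t pos by auto
    qed
    have "L (w t) j = L (z t) j" unfolding z_def generator_def by simp
    also have "\<dots> \<le> 0"
      using nbr[of "j + 1"] nbr[of "j - 1"] j(1) b_nonneg[of j] d_nonneg[of j]
      by (auto simp: generator_def intro!: add_nonpos_nonpos mult_nonneg_nonpos)
    finally have "w' t j - \<epsilon> < 0" using le[OF _ j(1), of t] t \<epsilon> by simp
    then obtain h where h: "h > 0" "\<And>k. k > 0 \<Longrightarrow> t - k \<in> {0..} \<Longrightarrow> k < h \<Longrightarrow> z t j < z (t - k) j"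
      using has_real_derivative_neg_dec_left[OF z_deriv[OF _ j(1), of t]] t by auto
    have "z t j < z (t - min (h / 2) t) j" using h(1) t0 by (intro h(2)) auto
    moreover have "z (t - min (h / 2) t) j \<le> z t j"
      using t h(1) j(1) by (intro max) auto
    ultimately show False by simp
  qed
  then have "z T i \<le> 0" using max[OF i, of T] T by simp
  then have "w T i \<le> \<epsilon> * T" by (simp add: z_def)
  also have "\<dots> \<le> \<epsilon>'" using T \<open>\<epsilon>' > 0\<close> by (simp add: \<epsilon>_def field_simps)
  finally show "w T i \<le> 0 + \<epsilon>'" by simp
qed

end

context bd_rates_lyapunov
begin

text \<open>As \<open>L \<phi> \<le> C\<close> on positive states, \<open>\<phi> k + C * t\<close>
  is a supersolution of the backward equation. Scaled by \<open>B / \<phi> (Suc N)\<close>, it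
  dominates the boundary value \<open>B\<close> at \<open>Suc N\<close>, yet at a fixed state it
  vanishes as \<open>N\<close> grows.\<close>

lemma maximum_principle_barrier:
  fixes u u' :: "real \<Rightarrow> nat \<Rightarrow> real"
  assumes deriv: "\<And>t i. 0 \<le> t \<Longrightarrow> i \<in> {1..N} \<Longrightarrow>
      ((\<lambda>s. u s i) has_real_derivative u' t i) (at t within {0..})"
    and le: "\<And>t i. 0 \<le> t \<Longrightarrow> i \<in> {1..N} \<Longrightarrow> u' t i \<le> L (u t) i"
    and init: "\<And>i. i \<in> {1..N} \<Longrightarrow> u 0 i \<le> 0"
    and bdry: "\<And>t. 0 \<le> t \<Longrightarrow> u t 0 \<le> 0" "\<And>t. 0 \<le> t \<Longrightarrow> u t (Suc N) \<le> B"
    and B: "0 \<le> B" and N: "\<phi> (Suc N) > 0"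
    and T: "0 \<le> T" and i: "i \<in> {1..N}"
  shows "u T i \<le> B / \<phi> (Suc N) * (\<phi> i + C * T)"
proof -
  define \<beta> where "\<beta> = B / \<phi> (Suc N)"
  have \<beta>: "\<beta> \<ge> 0" using B N by (simp add: \<beta>_def)
  define w where "w t k = u t k - \<beta> * (\<phi> k + C * t)" for t k
  have barrier_nonneg: "0 \<le> \<beta> * (\<phi> k + C * t)" if "0 \<le> t" for t k
    using \<beta> \<phi>_nonneg[of k] C_pos that by simp
  have "w T i \<le> 0"
  proof (rule maximum_principle[where w = w and w' = "\<lambda>t k. u' t k - \<beta> * C"])
    fix t :: real and k assume tk: "0 \<le> t" "k \<in> {1..N}"
    show "((\<lambda>s. w s k) has_real_derivative u' t k - \<beta> * C) (at t within {0..})"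
      unfolding w_def using deriv[OF tk] by (auto intro!: derivative_eq_intros)
    have "0 \<le> \<kappa> * \<phi> k" using \<phi>_nonneg[of k] \<kappa>_pos by simp
    then have "L \<phi> k \<le> C" using drift[of k] tk(2) by simp
    then have "\<beta> * L \<phi> k \<le> \<beta> * C" using \<beta> by (rule mult_left_mono)
    moreover have "L (\<lambda>k. \<phi> k + C * t) k = L \<phi> k" by (simp add: generator_def)
    ultimately show "u' t k - \<beta> * C \<le> L (w t) k"
      unfolding w_def generator_diff generator_scale using le[OF tk] by simp
  next
    fix k assume "k \<in> {1..N}"
    then show "w 0 k \<le> 0" using init[of k] barrier_nonneg[of 0 k] by (simp add: w_def)
  next
    fix t :: real assume t: "0 \<le> t"
    show "w t 0 \<le> 0" using bdry(1)[OF t] barrier_nonneg[OF t, of 0] by (simp add: w_def)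
    have "B \<le> \<beta> * (\<phi> (Suc N) + C * t)"
      using N B C_pos t by (simp add: \<beta>_def field_simps)
    then show "w t (Suc N) \<le> 0" using bdry(2)[OF t] by (simp add: w_def)
  qed (use T i in auto)
  then show ?thesis by (simp add: w_def \<beta>_def)
qed

lemma barrier_tendsto_0: "(\<lambda>N. B / \<phi> (Suc N) * y) \<longlonglongrightarrow> 0"
proof -
  have "filterlim (\<lambda>N. \<phi> (Suc N)) at_infinity sequentially"
    using \<phi>_tendsto by (intro filterlim_at_top_imp_at_infinity) (simp add: filterlim_sequentially_Suc)
  then have "(\<lambda>N. B / \<phi> (Suc N)) \<longlonglongrightarrow> 0" by (rule tendsto_divide_0[OF tendsto_const])
  then show ?thesis by (rule tendsto_mult_left_zero)
qed

lemma eventually_\<phi>_Suc_pos: "\<forall>\<^sub>F N in sequentially. \<phi> (Suc N) > 0"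
proof -
  have "filterlim (\<lambda>N. \<phi> (Suc N)) at_top sequentially"
    using \<phi>_tendsto by (simp add: filterlim_sequentially_Suc)
  then show ?thesis by (simp add: filterlim_at_top_dense)
qed

text \<open>The ratio \<open>q / Q x\<close> equals \<open>1\<close> at \<open>1\<close> and does
  not decrease, because the Wronskian of \<open>q\<close> and \<open>Q x\<close> stays
  nonnegative.\<close>

lemma q_ge_Q:
  assumes "\<xi> \<le> x" and pos: "\<And>n. n \<in> {1..N} \<Longrightarrow> Q x n > 0" and "n \<in> {1..N}"
  shows "Q x n \<le> q n"
proof -
  have "1 \<le> n" using assms(3) by simp
  then have "n \<le> N \<longrightarrow> W q (Q x) n \<ge> 0 \<and> Q x n \<le> q n"
  proof (induction n rule: dec_induct)
    case base
    then show ?case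
      using lagrange_identity_1[of q "Q x"] generator_Q[of 1] assms(1) by simp
  next
    case (step n)
    show ?case
    proof
      assume n: "Suc n \<le> N"
      have pos': "Q x n > 0" "Q x (Suc n) > 0" using pos n step.hyps by auto
      have "W q (Q x) n \<ge> 0" and IH: "Q x n \<le> q n" using step.IH n by auto
      then have "q n * Q x (Suc n) \<le> q (Suc n) * Q x n"
        using mult_pos_pos[OF pi_pos[of n] b_pos[OF step.hyps(1)]]
        unfolding bd_wronskian_def by (simp add: zero_le_mult_iff)
      moreover have "Q x n * Q x (Suc n) \<le> q n * Q x (Suc n)"
        using IH pos' by (intro mult_right_mono) auto
      ultimately have "Q x (Suc n) * Q x n \<le> q (Suc n) * Q x n" by (simp add: mult.commute)
      then have le: "Q x (Suc n) \<le> q (Suc n)" using pos' by simp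
      have "0 \<le> (x - \<xi>) * (Q x (Suc n) * q (Suc n))"
        using assms(1) pos' q_nonneg by simp
      then have "0 \<le> Q x (Suc n) * L q (Suc n) - q (Suc n) * L (Q x) (Suc n)"
        using generator_Q[of "Suc n"] by (simp add: algebra_simps del: bd_Q.simps)
      then have "W q (Q x) (Suc n) \<ge> 0"
        using lagrange_identity_Suc[OF step.hyps(1), of q "Q x"] \<open>W q (Q x) n \<ge> 0\<close> pi_nonneg[of "Suc n"]
        by (simp del: bd_Q.simps)
      then show "W q (Q x) (Suc n) \<ge> 0 \<and> Q x (Suc n) \<le> q (Suc n)" using le by simp
    qed
  qed
  then show ?thesis using assms(3) by simp
qed

end

section \<open>Transition probabilities\<close>

text \<open>Splitting an event by an integer-valued variable yields row sums, the Chapman-Kolmogorov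
  equation and the masses of a \<open>pmf\<close>.\<close>

lemma measure_fibres_sums:
  fixes g :: "'w \<Rightarrow> nat"
  assumes "finite_measure M" "E \<in> sets M" "g \<in> measurable M (count_space UNIV)"
  shows "(\<lambda>j. measure M {\<omega> \<in> E. g \<omega> = j}) sums measure M E"
proof -
  interpret finite_measure M by fact
  have "{\<omega> \<in> E. g \<omega> = j} = E \<inter> (g -` {j} \<inter> space M)" for j
    using sets.sets_into_space[OF assms(2)] by auto
  then have "range (\<lambda>j. {\<omega> \<in> E. g \<omega> = j}) \<subseteq> sets M"
    using assms(2) measurable_sets[OF assms(3)] by auto
  then have "(\<lambda>j. measure M {\<omega> \<in> E. g \<omega> = j}) sums measure M (\<Union>j. {\<omega> \<in> E. g \<omega> = j})"
    by (rule finite_measure_UNION) (auto simp: disjoint_family_on_def)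
  also have "(\<Union>j. {\<omega> \<in> E. g \<omega> = j}) = E" by auto
  finally show ?thesis .
qed

section \<open>The transition matrix and its backward equation\<close>

locale absorbed_birth_death = bd_rates b d + birth_death_process b d \<Omega> P X
  for b d :: "nat \<Rightarrow> real" and \<Omega> :: "'w measure" and P :: "nat \<Rightarrow> 'w measure"
    and X :: "real \<Rightarrow> 'w \<Rightarrow> nat"
begin

definition p :: "real \<Rightarrow> nat \<Rightarrow> nat \<Rightarrow> real" where
  "p t i j = measure (P i) {\<omega> \<in> space \<Omega>. X t \<omega> = j}"

lemma space_P: "space (P i) = space \<Omega>"
  using sets_P by (rule sets_eq_imp_space_eq)

lemma finite_measure_P: "finite_measure (P i)"
  using prob_space_P[of i] by (simp add: prob_space_def)

lemma measurable_X_P: "0 \<le> t \<Longrightarrow> X t \<in> measurable (P i) (count_space UNIV)"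
  using measurable_X measurable_cong_sets[OF sets_P refl] by blast

lemma sets_X: "0 \<le> t \<Longrightarrow> {\<omega> \<in> space \<Omega>. X t \<omega> \<in> A} \<in> sets \<Omega>"
  using measurable_sets[OF measurable_X, of t A] by (simp add: vimage_def Int_def conj_commute)

lemma sets_X_eq: "0 \<le> t \<Longrightarrow> {\<omega> \<in> space \<Omega>. X t \<omega> = j} \<in> sets \<Omega>"
  using sets_X[of t "{j}"] by simp

lemma p_nonneg: "0 \<le> p t i j"
  by (simp add: p_def)

lemma p_0: "p 0 i j = (if i = j then 1 else 0)"
proof -
  interpret prob_space "P i" by (rule prob_space_P)
  have m: "{\<omega> \<in> space (P i). X 0 \<omega> = j} \<in> sets (P i)"
    using sets_X_eq[of 0 j] by (simp add: space_P sets_P)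
  show ?thesis
  proof (cases "i = j")
    case True
    then have "prob {\<omega> \<in> space (P i). X 0 \<omega> = j} = 1"
      using start[of i] m by (subst prob_Collect_eq_1) auto
    then show ?thesis using True by (simp add: p_def space_P)
  next
    case False
    then have "prob {\<omega> \<in> space (P i). X 0 \<omega> = j} = 0"
      using start[of i] m by (subst prob_Collect_eq_0) auto
    then show ?thesis using False by (simp add: p_def space_P)
  qed
qed

lemma p_sums_1:
  assumes "0 \<le> t"
  shows "p t i sums 1"
proof -
  have "p t i = (\<lambda>j. measure (P i) {\<omega> \<in> space (P i). X t \<omega> = j})"
    by (auto simp: p_def space_P)
  then show ?thesis
    using measure_fibres_sums[OF finite_measure_P sets.top measurable_X_P[OF assms], of i]
      prob_space.prob_space[OF prob_space_P] by simp
qed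

lemma joint_law:
  assumes "0 \<le> s" "0 \<le> t"
  shows "measure (P i) {\<omega> \<in> space \<Omega>. X s \<omega> = k \<and> X (s + t) \<omega> = j} = p s i k * p t k j"
proof -
  have "space \<Omega> = space (history \<Omega> X s)"
    unfolding history_def by (subst space_measure_of) auto
  then have "space \<Omega> \<in> sets (history \<Omega> X s)" by (metis sets.top)
  from markov[OF assms this] show ?thesis by (simp add: p_def)
qed

lemma chapman_kolmogorov:
  assumes "0 \<le> s" "0 \<le> t"
  shows "(\<lambda>k. p s i k * p t k j) sums p (s + t) i j"
proof -
  have "(\<lambda>k. measure (P i) {\<omega> \<in> {\<omega> \<in> space \<Omega>. X (s + t) \<omega> = j}. X s \<omega> = k})
      sums measure (P i) {\<omega> \<in> space \<Omega>. X (s + t) \<omega> = j}"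
    using assms by (intro measure_fibres_sums finite_measure_P measurable_X_P) (auto simp: sets_P sets_X_eq)
  moreover have "{\<omega> \<in> {\<omega> \<in> space \<Omega>. X (s + t) \<omega> = j}. X s \<omega> = k}
      = {\<omega> \<in> space \<Omega>. X s \<omega> = k \<and> X (s + t) \<omega> = j}" for k by auto
  ultimately show ?thesis by (simp add: joint_law[OF assms] p_def[of "s + t"])
qed

lemma sum_p_le_1:
  assumes "0 \<le> t" "finite S"
  shows "(\<Sum>k\<in>S. p t i k) \<le> 1"
  using sum_le_suminf[OF sums_summable[OF p_sums_1[OF assms(1)]] assms(2)] p_nonneg
    sums_unique[OF p_sums_1[OF assms(1)]] by metis

lemma p_le_1: "0 \<le> t \<Longrightarrow> p t i j \<le> 1"
  using sum_p_le_1[of t "{j}"] by simp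

text \<open>In the Chapman-Kolmogorov sum, the states outside \<open>I\<close> contribute between
  \<open>0\<close> and their total mass, a bound uniform in \<open>t\<close>.\<close>

lemma p_step_bound:
  assumes "0 \<le> h" "0 \<le> t" "finite I"
  shows "\<bar>p (t + h) i j - (\<Sum>k\<in>I. p h i k * p t k j)\<bar> \<le> 1 - (\<Sum>k\<in>I. p h i k)"
proof -
  have tail: "(\<lambda>k. if k \<in> I then 0 else f k) sums (l - (\<Sum>k\<in>I. f k))"
    if "f sums l" for f :: "nat \<Rightarrow> real" and l
  proof -
    have "(\<lambda>k. f k - (if k \<in> I then f k else 0)) sums (l - (\<Sum>k\<in>I. f k))"
      by (intro sums_diff that sums_If_finite_set assms(3))
    moreover have "(\<lambda>k. f k - (if k \<in> I then f k else 0)) = (\<lambda>k. if k \<in> I then 0 else f k)"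
      by auto
    ultimately show ?thesis by simp
  qed
  note 1 = tail[OF chapman_kolmogorov[OF assms(1,2), of i j]]
  note 2 = tail[OF p_sums_1[OF assms(1), of i]]
  have "0 \<le> p (h + t) i j - (\<Sum>k\<in>I. p h i k * p t k j)"
    by (rule sums_le[OF _ sums_zero 1]) (auto intro: mult_nonneg_nonneg p_nonneg)
  moreover have "p (h + t) i j - (\<Sum>k\<in>I. p h i k * p t k j) \<le> 1 - (\<Sum>k\<in>I. p h i k)"
    using p_le_1[OF assms(2)] by (intro sums_le[OF _ 1 2]) (auto intro: mult_left_le p_nonneg)
  ultimately show ?thesis by (simp add: add.commute)
qed

lemma p_quotient_tendsto:
  "((\<lambda>h. (p h i j - p 0 i j) / h) \<longlongrightarrow> bd_rate b d i j) (at_right 0)"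
proof -
  have "((\<lambda>h. (p h i j - p 0 i j) / (h - 0)) \<longlongrightarrow> bd_rate b d i j) (at 0 within {0..})"
    using jump_rates[of i j] unfolding p_def has_field_derivative_iff .
  then show ?thesis by (auto elim: tendsto_within_subset)
qed

lemma p_tendsto_0: "((\<lambda>h. p h i j) \<longlongrightarrow> p 0 i j) (at_right 0)"
proof -
  have "((\<lambda>h. p h i j) \<longlongrightarrow> p 0 i j) (at 0 within {0..})"
    using DERIV_continuous[OF jump_rates[of i j]] unfolding p_def continuous_within by simp
  then show ?thesis by (auto elim: tendsto_within_subset)
qed

lemma continuous_on_p: "continuous_on {0..} (\<lambda>t. p t i j)"
proof (rule continuous_on_of_right_modulus)
  show "\<bar>p (t + h) i j - p t i j\<bar> \<le> 2 * (1 - p h i i)" if "0 \<le> t" "0 < h" for t h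
  proof -
    have "\<bar>p (t + h) i j - p h i i * p t i j\<bar> \<le> 1 - p h i i"
      using p_step_bound[of h t "{i}" i j] that by simp
    moreover have "0 \<le> (1 - p h i i) * p t i j" "(1 - p h i i) * p t i j \<le> 1 - p h i i"
      using that p_le_1[of h i i] p_le_1[of t i j] p_nonneg[of t i j]
      by (auto intro: mult_left_le)
    ultimately show ?thesis by (simp add: algebra_simps abs_le_iff)
  qed
  show "((\<lambda>h. 2 * (1 - p h i i)) \<longlongrightarrow> 0) (at_right 0)"
    using p_tendsto_0[of i i] by (auto intro!: tendsto_eq_intros simp: p_0)
qed

text \<open>Since the rates out of \<open>i\<close> sum to \<open>0\<close>, jumps to states
  other than the neighbours have probability \<open>o(h)\<close>, uniformly in \<open>t\<close>.\<close>

lemma backward_equation: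
  assumes "0 \<le> t"
  shows "((\<lambda>s. p s i j) has_real_derivative L (\<lambda>k. p t k j) i) (at t within {0..})"
proof -
  define I where "I = {i - 1, i, i + 1}"
  have I: "finite I" "i \<in> I" by (auto simp: I_def)
  have sum_I: "(\<Sum>k\<in>I. bd_rate b d i k * u k) = L u i" for u
  \<comment> \<open>For \<open>i = 0\<close>, truncated subtraction reduces \<open>I\<close> to
    \<open>{0, 1}\<close>, and the whole row of rates is zero.\<close>
  proof (cases "i = 0")
    case True
    then show ?thesis by (simp add: I_def bd_rate_def generator_def b_0 d_0)
  next
    case False
    then show ?thesis using I by (intro sum_rate_eq_generator) (auto simp: I_def bd_rate_def)
  qed
  \<comment> \<open>The first sum measures the error in the rates to \<open>I\<close>; the last term
    is the mass outside \<open>I\<close> divided by \<open>h\<close>.\<close>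
  define \<eta> where "\<eta> h = (\<Sum>k\<in>I. \<bar>(p h i k - p 0 i k) / h - bd_rate b d i k\<bar>)
      + \<bar>\<Sum>k\<in>I. (p h i k - p 0 i k) / h\<bar>" for h
  show ?thesis
  proof (rule has_real_derivative_of_uniform_right_derivative[where \<eta> = \<eta>])
    fix t h :: real assume t: "0 \<le> t" and h: "0 < h"
    have p0_sum: "(\<Sum>k\<in>I. p 0 i k * u k) = u i" for u
      using I by (simp add: p_0 if_distrib[of "\<lambda>x. x * _"] cong: if_cong)
    have "h * (\<Sum>k\<in>I. ((p h i k - p 0 i k) / h - bd_rate b d i k) * p t k j)
        = (\<Sum>k\<in>I. p h i k * p t k j - p 0 i k * p t k j - h * (bd_rate b d i k * p t k j))"
      unfolding sum_distrib_left using h by (intro sum.cong) (auto simp: field_simps)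
    also have "\<dots> = (\<Sum>k\<in>I. p h i k * p t k j) - p t i j - h * L (\<lambda>k. p t k j) i"
      by (simp add: sum_subtractf p0_sum sum_I flip: sum_distrib_left)
    finally have "p (t + h) i j - p t i j - h * L (\<lambda>k. p t k j) i
        = (p (t + h) i j - (\<Sum>k\<in>I. p h i k * p t k j))
          + h * (\<Sum>k\<in>I. ((p h i k - p 0 i k) / h - bd_rate b d i k) * p t k j)"
      by simp
    moreover have "\<bar>p (t + h) i j - (\<Sum>k\<in>I. p h i k * p t k j)\<bar> \<le> h * \<bar>\<Sum>k\<in>I. (p h i k - p 0 i k) / h\<bar>"
    proof -
      have "h * (\<Sum>k\<in>I. (p h i k - p 0 i k) / h) = (\<Sum>k\<in>I. p h i k) - 1"
        using h p0_sum[of "\<lambda>_. 1"] by (simp add: sum_divide_distrib[symmetric] sum_subtractf)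
      moreover have "h * \<bar>\<Sum>k\<in>I. (p h i k - p 0 i k) / h\<bar> = \<bar>h * (\<Sum>k\<in>I. (p h i k - p 0 i k) / h)\<bar>"
        using h by (simp add: abs_mult)
      ultimately show ?thesis using p_step_bound[of h t I i j] h t I by simp
    qed
    moreover have "\<bar>\<Sum>k\<in>I. ((p h i k - p 0 i k) / h - bd_rate b d i k) * p t k j\<bar>
        \<le> (\<Sum>k\<in>I. \<bar>(p h i k - p 0 i k) / h - bd_rate b d i k\<bar>)"
      using p_le_1[OF t] p_nonneg
      by (intro order_trans[OF sum_abs] sum_mono) (auto simp: abs_mult intro: mult_left_le)
    then have "\<bar>h * (\<Sum>k\<in>I. ((p h i k - p 0 i k) / h - bd_rate b d i k) * p t k j)\<bar>
        \<le> h * (\<Sum>k\<in>I. \<bar>(p h i k - p 0 i k) / h - bd_rate b d i k\<bar>)"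
      using h by (simp add: abs_mult)
    ultimately show "\<bar>p (t + h) i j - p t i j - h * L (\<lambda>k. p t k j) i\<bar> \<le> h * \<eta> h"
      unfolding \<eta>_def distrib_left by linarith
  next
    have "(\<Sum>k\<in>I. bd_rate b d i k) = 0" using sum_I[of "\<lambda>_. 1"] by (simp add: generator_def)
    moreover have "(\<eta> \<longlongrightarrow> (\<Sum>k\<in>I. \<bar>bd_rate b d i k - bd_rate b d i k\<bar>) + \<bar>\<Sum>k\<in>I. bd_rate b d i k\<bar>) (at_right 0)"
      unfolding \<eta>_def by (intro tendsto_intros p_quotient_tendsto)
    ultimately show "(\<eta> \<longlongrightarrow> 0) (at_right 0)" by simp
  next
    show "continuous_on {0..} (\<lambda>t. L (\<lambda>k. p t k j) i)"
      unfolding generator_def by (cases "i = 0") (auto intro!: continuous_intros continuous_on_p)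
  qed fact
qed

lemma p_absorbed:
  assumes "0 \<le> t"
  shows "p t 0 j = (if j = 0 then 1 else 0)"
proof -
  have "\<exists>c. \<forall>s\<in>{0..}. p s 0 j = c"
  proof (rule has_field_derivative_zero_constant)
    fix s :: real assume "s \<in> {0..}"
    then show "((\<lambda>s. p s 0 j) has_field_derivative 0) (at s within {0..})"
      using backward_equation[of s 0 j] by (simp add: generator_def)
  qed simp
  then have "p t 0 j = p 0 0 j" using assms by auto
  then show ?thesis by (simp add: p_0)
qed

text \<open>For each \<open>j \<noteq> 0\<close>, the joint law contains the factor
  \<open>p (t - s) 0 j = 0\<close>, and there are only countably many \<open>j\<close>.\<close>

lemma AE_absorbed:
  assumes "0 \<le> s" "s \<le> t"
  shows "AE \<omega> in P i. X s \<omega> = 0 \<longrightarrow> X t \<omega> = 0"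
proof -
  interpret prob_space "P i" by (rule prob_space_P)
  have "AE \<omega> in P i. \<not> (X s \<omega> = 0 \<and> X t \<omega> = j)" if "j \<noteq> 0" for j
  proof (rule prob_Collect_eq_0[THEN iffD1])
    show "{\<omega> \<in> space (P i). X s \<omega> = 0 \<and> X t \<omega> = j} \<in> sets (P i)"
      using sets.Int[OF sets_X_eq[of s 0] sets_X_eq[of t j]] assms
      by (simp add: space_P sets_P Int_def conj_ac cong: conj_cong)
    show "prob {\<omega> \<in> space (P i). X s \<omega> = 0 \<and> X t \<omega> = j} = 0"
      using joint_law[of s "t - s" i 0 j] assms that by (simp add: space_P p_absorbed)
  qed
  then have "AE \<omega> in P i. \<forall>j. j \<noteq> 0 \<longrightarrow> \<not> (X s \<omega> = 0 \<and> X t \<omega> = j)"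
    by (subst AE_all_countable) auto
  then show ?thesis by eventually_elim auto
qed

end

section \<open>Reversibility and the eigenfunction of the semigroup\<close>

locale lyapunov_birth_death =
  bd_rates_lyapunov b d C \<kappa> \<phi> + absorbed_birth_death b d \<Omega> P X
  for b d :: "nat \<Rightarrow> real" and C \<kappa> :: real and \<phi> :: "nat \<Rightarrow> real"
    and \<Omega> :: "'w measure" and P :: "nat \<Rightarrow> 'w measure" and X :: "real \<Rightarrow> 'w \<Rightarrow> nat"
begin

text \<open>Extended by zero, \<open>e\<close> solves the backward equation on
  \<open>{1..N}\<close>. Its difference from \<open>p\<close> vanishes at time \<open>0\<close> and
  at state \<open>0\<close>, and is at most \<open>1\<close> in absolute value at
  \<open>Suc N\<close>, so the barrier applies to both signs.\<close>

lemma truncated_semigroup_approx: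
  assumes deriv: "\<And>t i. i \<in> {1..N} \<Longrightarrow>
      ((\<lambda>t. e t i) has_real_derivative (\<Sum>k\<in>{1..N}. bd_rate b d i k * e t k)) (at t)"
    and e_0: "\<And>i. e 0 i = (if i = j then 1 else 0)"
    and i: "i \<in> {1..N}" and j: "j \<in> {1..N}" and t: "0 \<le> t" and N: "\<phi> (Suc N) > 0"
  shows "\<bar>p t i j - e t i\<bar> \<le> 1 / \<phi> (Suc N) * (\<phi> i + C * t)"
proof -
  define z where "z s k = (if k \<in> {1..N} then e s k else 0)" for s k
  have z_deriv: "((\<lambda>s. z s k) has_real_derivative L (z s) k) (at s within {0..})"
    if "k \<in> {1..N}" for s k
  proof -
    have "(\<Sum>l\<in>{1..N}. bd_rate b d k l * e s l) = (\<Sum>l\<in>{1..N}. bd_rate b d k l * z s l)"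
      by (intro sum.cong) (auto simp: z_def)
    also have "\<dots> = L (z s) k"
      using that by (intro sum_rate_eq_generator) (auto simp: z_def)
    finally show ?thesis
      using deriv[OF that, of s] that by (auto simp: z_def[abs_def] intro: has_field_derivative_at_within)
  qed
  have z_bdry: "z s 0 = 0" "z s (Suc N) = 0" for s by (auto simp: z_def)
  have z_0: "z 0 k = (if k = j then 1 else 0)" if "k \<in> {1..N}" for k
    using that by (simp add: z_def e_0)
  have j0: "j \<noteq> 0" using j by auto
  have "p t i j - z t i \<le> 1 / \<phi> (Suc N) * (\<phi> i + C * t)"
  proof (rule maximum_principle_barrier[where u = "\<lambda>s k. p s k j - z s k"
        and u' = "\<lambda>s k. L (\<lambda>k. p s k j) k - L (z s) k"])
    fix s :: real and k assume "0 \<le> s" "k \<in> {1..N}"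
    then show "((\<lambda>s. p s k j - z s k) has_real_derivative L (\<lambda>k. p s k j) k - L (z s) k) (at s within {0..})"
      by (intro DERIV_diff backward_equation z_deriv)
  qed (use i t N j0 in \<open>auto simp: generator_diff p_0 p_absorbed p_le_1 z_bdry z_0\<close>)
  moreover have "z t i - p t i j \<le> 1 / \<phi> (Suc N) * (\<phi> i + C * t)"
  proof (rule maximum_principle_barrier[where u = "\<lambda>s k. z s k - p s k j"
        and u' = "\<lambda>s k. L (z s) k - L (\<lambda>k. p s k j) k"])
    fix s :: real and k assume "0 \<le> s" "k \<in> {1..N}"
    then show "((\<lambda>s. z s k - p s k j) has_real_derivative L (z s) k - L (\<lambda>k. p s k j) k) (at s within {0..})"
      by (intro DERIV_diff backward_equation z_deriv)
  next
    fix s :: real assume "0 \<le> s"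
    show "z s (Suc N) - p s (Suc N) j \<le> 1" using p_nonneg[of s "Suc N" j] by (simp add: z_bdry)
  qed (use i t N j0 in \<open>auto simp: generator_diff p_0 p_absorbed z_bdry z_0\<close>)
  ultimately show ?thesis using i by (simp add: z_def abs_le_iff)
qed

text \<open>Reversibility passes from the finite truncations to the limit.\<close>

lemma p_reversible:
  assumes i: "1 \<le> i" and j: "1 \<le> j" and t: "0 \<le> t"
  shows "\<pi> i * p t i j = \<pi> j * p t j i"
proof -
  define \<epsilon> where "\<epsilon> N = \<pi> i * (1 / \<phi> (Suc N) * (\<phi> i + C * t)) + \<pi> j * (1 / \<phi> (Suc N) * (\<phi> j + C * t))" for N
  have "\<bar>\<pi> i * p t i j - \<pi> j * p t j i\<bar> \<le> 0"
  proof (rule tendsto_lowerbound)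
    show "\<epsilon> \<longlonglongrightarrow> 0" unfolding \<epsilon>_def
      by (intro tendsto_add_zero tendsto_mult_right_zero barrier_tendsto_0)
    have bound: "\<bar>\<pi> i * p t i j - \<pi> j * p t j i\<bar> \<le> \<epsilon> N" if N: "\<phi> (Suc N) > 0" "max i j \<le> N" for N
    proof -
      obtain e where e:
        "\<And>t i j. i \<in> {1..N} \<Longrightarrow> j \<in> {1..N} \<Longrightarrow>
          ((\<lambda>t. e t i j) has_real_derivative (\<Sum>k\<in>{1..N}. bd_rate b d i k * e t k j)) (at t)"
        "\<And>i j. e 0 i j = (if i = j then 1 else 0)"
        "\<And>t i j. i \<in> {1..N} \<Longrightarrow> j \<in> {1..N} \<Longrightarrow> \<pi> i * e t i j = \<pi> j * e t j i"
      proof (rule reversible_matrix_exponential[of "{1..N}" \<pi> "bd_rate b d"])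
        show "\<pi> i * bd_rate b d i j = \<pi> j * bd_rate b d j i" if "i \<in> {1..N}" "j \<in> {1..N}" for i j
          using that by (intro pi_rate_symmetric) auto
      qed (simp, rule that)
      have ij: "i \<in> {1..N}" "j \<in> {1..N}" using i j N by auto
      have "\<bar>p t i j - e t i j\<bar> \<le> 1 / \<phi> (Suc N) * (\<phi> i + C * t)"
        using ij e(1,2) t N by (intro truncated_semigroup_approx) auto
      then have 1: "\<pi> i * \<bar>p t i j - e t i j\<bar> \<le> \<pi> i * (1 / \<phi> (Suc N) * (\<phi> i + C * t))"
        by (rule mult_left_mono[OF _ pi_nonneg])
      have "\<bar>p t j i - e t j i\<bar> \<le> 1 / \<phi> (Suc N) * (\<phi> j + C * t)"
        using ij e(1,2) t N by (intro truncated_semigroup_approx) auto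
      then have 2: "\<pi> j * \<bar>p t j i - e t j i\<bar> \<le> \<pi> j * (1 / \<phi> (Suc N) * (\<phi> j + C * t))"
        by (rule mult_left_mono[OF _ pi_nonneg])
      \<comment> \<open>The truncated terms cancel by reversibility, leaving only approximation
        errors.\<close>
      have "\<pi> i * p t i j - \<pi> j * p t j i = \<pi> i * (p t i j - e t i j) - \<pi> j * (p t j i - e t j i)"
        using e(3)[OF ij, of t] by (simp add: algebra_simps)
      then have "\<bar>\<pi> i * p t i j - \<pi> j * p t j i\<bar> \<le> \<pi> i * \<bar>p t i j - e t i j\<bar> + \<pi> j * \<bar>p t j i - e t j i\<bar>"
        using abs_triangle_ineq4[of "\<pi> i * (p t i j - e t i j)" "\<pi> j * (p t j i - e t j i)"]
          pi_nonneg[of i] pi_nonneg[of j] by (simp add: abs_mult)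
      also note add_mono[OF 1 2]
      finally show ?thesis unfolding \<epsilon>_def .
    qed
    show "\<forall>\<^sub>F N in sequentially. \<bar>\<pi> i * p t i j - \<pi> j * p t j i\<bar> \<le> \<epsilon> N"
      using eventually_\<phi>_Suc_pos eventually_ge_at_top[of "max i j"] by eventually_elim (rule bound)
  qed simp
  then show ?thesis by simp
qed

text \<open>Both sides solve the backward equation. With \<open>M\<close> fixed, monotonicity of
  \<open>q\<close> bounds the partial sum at \<open>Suc N\<close> by \<open>q M\<close>,
  independently of \<open>N\<close>, so the barrier error disappears as \<open>N\<close>
  grows.\<close>

lemma sum_p_q_le:
  assumes i: "1 \<le> i" and t: "0 \<le> t"
  shows "(\<Sum>l\<le>M. p t i l * q l) \<le> exp (- \<xi> * t) * q i"
proof -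
  define \<epsilon> where "\<epsilon> N = q M / \<phi> (Suc N) * (\<phi> i + C * t)" for N
  have "(\<Sum>l\<le>M. p t i l * q l) - exp (- \<xi> * t) * q i \<le> 0"
  proof (rule tendsto_lowerbound)
    show "\<epsilon> \<longlonglongrightarrow> 0" unfolding \<epsilon>_def by (rule barrier_tendsto_0)
    have bound: "(\<Sum>l\<le>M. p t i l * q l) - exp (- \<xi> * t) * q i \<le> \<epsilon> N"
      if N: "\<phi> (Suc N) > 0" "max i M \<le> N" for N
      unfolding \<epsilon>_def
    proof (rule maximum_principle_barrier[where u = "\<lambda>s k. (\<Sum>l\<le>M. p s k l * q l) - exp (- \<xi> * s) * q k"
          and u' = "\<lambda>s k. L (\<lambda>k. (\<Sum>l\<le>M. p s k l * q l) - exp (- \<xi> * s) * q k) k"])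
      fix s :: real and k assume s: "0 \<le> s" and k: "k \<in> {1..N}"
      have "L (\<lambda>k. (\<Sum>l\<le>M. p s k l * q l) - exp (- \<xi> * s) * q k) k
          = (\<Sum>l\<le>M. L (\<lambda>k. p s k l) k * q l) - (- \<xi> * exp (- \<xi> * s)) * q k"
        using k generator_Q[of k \<xi>]
        by (simp add: generator_diff generator_sum generator_scale generator_scale_right)
      moreover have "((\<lambda>s. (\<Sum>l\<le>M. p s k l * q l) - exp (- \<xi> * s) * q k) has_real_derivative
          (\<Sum>l\<le>M. L (\<lambda>k. p s k l) k * q l) - (- \<xi> * exp (- \<xi> * s)) * q k) (at s within {0..})"
        by (auto intro!: derivative_eq_intros backward_equation[OF s] simp: mult.commute)
      ultimately show "((\<lambda>s. (\<Sum>l\<le>M. p s k l * q l) - exp (- \<xi> * s) * q k) has_real_derivative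
          L (\<lambda>k. (\<Sum>l\<le>M. p s k l * q l) - exp (- \<xi> * s) * q k) k) (at s within {0..})" by simp
    next
      fix k
      show "(\<Sum>l\<le>M. p 0 k l * q l) - exp (- \<xi> * 0) * q k \<le> 0"
        using q_nonneg[of k] by (simp add: p_0 if_distrib[of "\<lambda>x. x * _"] cong: if_cong)
    next
      fix s :: real assume s: "0 \<le> s"
      have "p s 0 l * q l = 0" for l using s by (cases l) (auto simp: p_absorbed)
      then have "(\<Sum>l\<le>M. p s 0 l * q l) = 0" by (simp only: sum.neutral_const)
      then show "(\<Sum>l\<le>M. p s 0 l * q l) - exp (- \<xi> * s) * q 0 \<le> 0" by simp
      have "(\<Sum>l\<le>M. p s (Suc N) l * q l) \<le> (\<Sum>l\<le>M. p s (Suc N) l * q M)"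
        using p_nonneg monoD[OF q_mono] by (intro sum_mono mult_left_mono) auto
      also have "\<dots> \<le> 1 * q M"
        unfolding sum_distrib_right[symmetric] using sum_p_le_1[OF s] q_nonneg by (intro mult_right_mono) auto
      finally show "(\<Sum>l\<le>M. p s (Suc N) l * q l) - exp (- \<xi> * s) * q (Suc N) \<le> q M"
        using mult_nonneg_nonneg[OF exp_ge_zero[of "- \<xi> * s"] q_nonneg[of "Suc N"]] by linarith
    qed (use N i t q_nonneg in auto)
    show "\<forall>\<^sub>F N in sequentially. (\<Sum>l\<le>M. p t i l * q l) - exp (- \<xi> * t) * q i \<le> \<epsilon> N"
      using eventually_\<phi>_Suc_pos eventually_ge_at_top[of "max i M"] by eventually_elim (rule bound)
  qed simp
  then show ?thesis by simp
qed

text \<open>Above \<open>\<xi>\<close>, cutting \<open>Q x\<close> off at its first nonpositive value gives a subsolution of finite support.\<close>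

lemma suminf_p_Q_ge:
  assumes i: "1 \<le> i" and t: "0 \<le> t" and x: "\<xi> < x" and pos: "\<And>n. n \<in> {1..i} \<Longrightarrow> Q x n > 0"
    and summable_pq: "summable (\<lambda>l. p t i l * q l)"
  shows "exp (- x * t) * Q x i \<le> (\<Sum>l. p t i l * q l)"
proof -
  have ex: "\<exists>n. n \<ge> 1 \<and> Q x n \<le> 0" using xi_iff[of x] x by (auto simp: not_less)
  define N where "N = (LEAST n. n \<ge> 1 \<and> Q x n \<le> 0) - 1"
  define m where "m = (LEAST n. n \<ge> 1 \<and> Q x n \<le> 0)"
  have m: "m \<ge> 1" "Q x m \<le> 0" using LeastI_ex[OF ex] by (auto simp: m_def)
  have m_N: "m = Suc N" using m by (simp add: m_def N_def)
  have N_pos: "Q x n > 0" if "n \<in> {1..N}" for n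
    using not_less_Least[of n "\<lambda>n. n \<ge> 1 \<and> Q x n \<le> 0"] that m_N unfolding m_def by auto
  have "\<not> m \<le> i" using pos[of m] m by auto
  then have i_N: "i \<in> {1..N}" using m_N i by simp
  define f where "f k = (if k \<in> {1..N} then Q x k else 0)" for k
  have f_bdry: "f 0 = 0" "f (Suc N) = 0" by (auto simp: f_def)
  have f_nonneg: "0 \<le> f k" for k using N_pos[of k] by (simp add: f_def less_imp_le)
  have Lf: "- x * f k \<le> L f k" if k: "k \<in> {1..N}" for k
  proof -
    \<comment> \<open>At \<open>k = N\<close>, the cut-off replaces the nonpositive value at
      \<open>Suc N\<close> by \<open>0\<close>, which can only increase the generator.\<close>
    have "f (k + 1) \<ge> Q x (k + 1)" using k m m_N by (cases "k = N") (auto simp: f_def)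
    moreover have "f (k - 1) = Q x (k - 1)" using k by (cases "k = 1") (auto simp: f_def)
    moreover have "f k = Q x k" using k by (simp add: f_def)
    ultimately have "L (Q x) k \<le> L f k"
      using k b_nonneg[of k] by (auto simp: generator_def intro!: mult_left_mono)
    then show ?thesis using generator_Q[of k x] k \<open>f k = Q x k\<close> by simp
  qed
  have "exp (- x * t) * f i - (\<Sum>l\<le>N. p t i l * f l) \<le> 0"
  proof (rule maximum_principle[where w = "\<lambda>s k. exp (- x * s) * f k - (\<Sum>l\<le>N. p s k l * f l)"
        and w' = "\<lambda>s k. - x * exp (- x * s) * f k - (\<Sum>l\<le>N. L (\<lambda>k. p s k l) k * f l)"])
    fix s :: real and k assume s: "0 \<le> s" and k: "k \<in> {1..N}"
    show "((\<lambda>s. exp (- x * s) * f k - (\<Sum>l\<le>N. p s k l * f l)) has_real_derivative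
        - x * exp (- x * s) * f k - (\<Sum>l\<le>N. L (\<lambda>k. p s k l) k * f l)) (at s within {0..})"
      by (auto intro!: derivative_eq_intros backward_equation[OF s] simp: mult.commute)
    have "- x * exp (- x * s) * f k \<le> exp (- x * s) * L f k"
      using mult_left_mono[OF Lf[OF k], of "exp (- x * s)"] by (simp add: mult_ac)
    then show "- x * exp (- x * s) * f k - (\<Sum>l\<le>N. L (\<lambda>k. p s k l) k * f l)
        \<le> L (\<lambda>k. exp (- x * s) * f k - (\<Sum>l\<le>N. p s k l * f l)) k"
      by (simp add: generator_diff generator_sum generator_scale generator_scale_right)
  next
    fix k assume "k \<in> {1..N}"
    then show "exp (- x * 0) * f k - (\<Sum>l\<le>N. p 0 k l * f l) \<le> 0"
      by (simp add: p_0 if_distrib[of "\<lambda>x. x * _"] cong: if_cong)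
  next
    fix s :: real assume "0 \<le> s"
    show "exp (- x * s) * f 0 - (\<Sum>l\<le>N. p s 0 l * f l) \<le> 0"
      by (simp add: f_bdry sum_nonneg p_nonneg f_nonneg)
    show "exp (- x * s) * f (Suc N) - (\<Sum>l\<le>N. p s (Suc N) l * f l) \<le> 0"
      by (simp add: f_bdry sum_nonneg p_nonneg f_nonneg)
  qed (use i_N t in auto)
  then have "exp (- x * t) * Q x i \<le> (\<Sum>l\<le>N. p t i l * f l)" using i_N by (simp add: f_def)
  also have "\<dots> \<le> (\<Sum>l\<le>N. p t i l * q l)"
    using q_ge_Q[of x N] x N_pos q_nonneg p_nonneg by (intro sum_mono mult_left_mono) (auto simp: f_def)
  also have "\<dots> \<le> (\<Sum>l. p t i l * q l)"
    using p_nonneg q_nonneg by (intro sum_le_suminf summable_pq) auto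
  finally show ?thesis .
qed

text \<open>The upper bound comes from partial sums, the lower one from letting \<open>x\<close>
  decrease to \<open>\<xi>\<close> in \<open>suminf_p_Q_ge\<close>.\<close>

lemma p_q_sums:
  assumes i: "1 \<le> i" and t: "0 \<le> t"
  shows "(\<lambda>l. p t i l * q l) sums (exp (- \<xi> * t) * q i)"
proof -
  have summable_pq: "summable (\<lambda>l. p t i l * q l)"
    using sum_p_q_le[OF assms] p_nonneg q_nonneg by (intro bounded_imp_summable) auto
  have "(\<Sum>l. p t i l * q l) \<le> exp (- \<xi> * t) * q i"
  proof (rule suminf_le_const[OF summable_pq])
    fix n
    have "(\<Sum>l<n. p t i l * q l) \<le> (\<Sum>l\<le>n. p t i l * q l)"
      using p_nonneg q_nonneg by (intro sum_mono2) auto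
    then show "(\<Sum>l<n. p t i l * q l) \<le> exp (- \<xi> * t) * q i"
      using sum_p_q_le[OF assms, of n] by simp
  qed
  moreover have "exp (- \<xi> * t) * q i \<le> (\<Sum>l. p t i l * q l)"
  proof (rule tendsto_upperbound)
    have "isCont (\<lambda>x. exp (- x * t) * Q x i) \<xi>"
      using continuous_bd_Q by (intro continuous_intros)
    then show "((\<lambda>x. exp (- x * t) * Q x i) \<longlongrightarrow> exp (- \<xi> * t) * q i) (at_right \<xi>)"
      by (simp add: isCont_def filterlim_at_split)
    have "\<forall>\<^sub>F x in at_right \<xi>. \<xi> < x" by (simp add: eventually_at_filter)
    then show "\<forall>\<^sub>F x in at_right \<xi>. exp (- x * t) * Q x i \<le> (\<Sum>l. p t i l * q l)"
      using eventually_Q_pos[of i] by eventually_elim (use suminf_p_Q_ge[OF assms] summable_pq in auto)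
  qed simp
  ultimately show ?thesis using summable_pq by (simp add: sums_iff)
qed

end

section \<open>Recurrence and quasi-stationarity\<close>

context lyapunov_birth_death
begin

text \<open>By reversibility, \<open>p (s + t) 1 1\<close> is an inner product of the rows \<open>p s 1\<close> and \<open>p t 1\<close>. The
  return probability is therefore midpoint convex in \<open>t\<close>, and bounded below in terms of \<open>\<Sum>n. \<pi> n * (q n)\<^sup>2\<close>.\<close>

lemma return_probability_tendsto:
  obtains l where "0 < l" "((\<lambda>t. exp (\<xi> * t) * p t 1 1) \<longlongrightarrow> l) at_top"
proof -
  define f where "f t = exp (\<xi> * t) * p t 1 1" for t
  \<comment> \<open>Reversibility excludes the absorbing state; setting its entry to
    \<open>0\<close> loses nothing, as \<open>1\<close> cannot be reached from
    \<open>0\<close>.\<close>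
  define a where "a t j = (if j = 0 then 0 else exp (\<xi> * t) * p t 1 j)" for t j
  have f_sums: "(\<lambda>j. a s j * a t j / \<pi> j) sums f (s + t)" if "0 \<le> s" "0 \<le> t" for s t
  proof -
    have "exp (\<xi> * (s + t)) * (p s 1 j * p t j 1) = a s j * a t j / \<pi> j" for j
    proof (cases "j = 0")
      case True
      then show ?thesis using that by (simp add: p_absorbed a_def)
    next
      case False
      then have "p t j 1 = p t 1 j / \<pi> j"
        using p_reversible[of 1 j t] pi_pos[of j] that by (simp add: pi_1 field_simps)
      then show ?thesis using False by (simp add: a_def exp_add algebra_simps)
    qed
    then show ?thesis
      using sums_mult[OF chapman_kolmogorov[OF that, of 1 1], of "exp (\<xi> * (s + t))"] by (simp add: f_def)
  qed
  have q_sums: "(\<lambda>j. a t j * q j) sums 1" if "0 \<le> t" for t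
  proof -
    have "(\<lambda>j. exp (\<xi> * t) * (p t 1 j * q j)) sums (exp (\<xi> * t) * (exp (- \<xi> * t) * q 1))"
      by (intro sums_mult p_q_sums that) simp
    moreover have "exp (\<xi> * t) * (p t 1 j * q j) = a t j * q j" for j by (simp add: a_def)
    moreover have "exp (\<xi> * t) * (exp (- \<xi> * t) * q 1) = 1" by (simp add: exp_minus)
    ultimately show ?thesis by (simp only:)
  qed
  define Z where "Z = (\<Sum>n. \<pi> n * (q n)\<^sup>2)"
  have Z_sums: "(\<lambda>n. \<pi> n * (q n)\<^sup>2) sums Z"
    using summable_pi_q_sq by (simp add: Z_def summable_sums)
  have Z_pos: "0 < Z"
    unfolding Z_def using summable_pi_q_sq pi_nonneg pi_1 by (intro suminf_pos2[of _ 1]) auto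
  obtain l where l: "1 / Z \<le> l" "(f \<longlongrightarrow> l) at_top"
  proof (rule tendsto_at_top_of_bounded_midpoint_convex[where f = f and B = 1 and c = "1 / Z"])
    fix s t :: real assume st: "0 \<le> s" "0 \<le> t"
    have 1: "(\<lambda>j. (a s j * a s j / \<pi> j + a t j * a t j / \<pi> j) / 2) sums ((f (s + s) + f (t + t)) / 2)"
      by (rule sums_divide[OF sums_add[OF f_sums[OF st(1) st(1)] f_sums[OF st(2) st(2)]]])
    have "a s j * a t j / \<pi> j \<le> (a s j * a s j / \<pi> j + a t j * a t j / \<pi> j) / 2" for j
    proof -
      have "0 \<le> (a s j - a t j)\<^sup>2 / \<pi> j" using pi_nonneg by simp
      then show ?thesis
        by (simp add: power2_eq_square algebra_simps add_divide_distrib diff_divide_distrib)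
    qed
    from sums_le[OF this f_sums[OF st] 1]
    show "f (s + t) \<le> (f (2 * s) + f (2 * t)) / 2" by (simp only: mult_2)
  next
    fix t :: real assume t: "0 \<le> t"
    \<comment> \<open>Only the term \<open>j = 1\<close> of \<open>q_sums\<close> is kept, where
      \<open>q 1 = 1\<close>.\<close>
    have "a t 1 * q 1 = (\<Sum>j\<in>{1}. a t j * q j)" by simp
    also have "\<dots> \<le> (\<Sum>j. a t j * q j)"
      using q_sums[OF t] p_nonneg q_nonneg by (intro sum_le_suminf) (auto simp: sums_iff a_def)
    also have "\<dots> = 1" using q_sums[OF t] by (simp add: sums_iff)
    finally show "f t \<le> 1" by (simp add: a_def f_def)
    define r where "r = t / 2"
    have r: "0 \<le> r" "r + r = t" using t by (auto simp: r_def)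
    \<comment> \<open>Cauchy-Schwarz in arithmetic-geometric form: with weight \<open>Z\<close>,
      summation gives \<open>1 \<le> (Z * f t + 1) / 2\<close>.\<close>
    have 2: "a r j * q j \<le> (Z * (a r j * a r j / \<pi> j) + \<pi> j * (q j)\<^sup>2 / Z) / 2" for j
    proof -
      have "0 \<le> (Z * a r j - \<pi> j * q j)\<^sup>2 / (Z * \<pi> j)" using pi_nonneg[of j] Z_pos by simp
      also have "\<dots> = Z * (a r j * a r j / \<pi> j) + \<pi> j * (q j)\<^sup>2 / Z - 2 * (a r j * q j)"
        using Z_pos pi_pos[of j] by (simp add: power2_eq_square field_simps)
      finally show ?thesis by simp
    qed
    have 3: "(\<lambda>j. (Z * (a r j * a r j / \<pi> j) + \<pi> j * (q j)\<^sup>2 / Z) / 2) sums ((Z * f (r + r) + Z / Z) / 2)"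
      by (rule sums_divide[OF sums_add[OF sums_mult[OF f_sums[OF r(1) r(1)]] sums_divide[OF Z_sums]]])
    from sums_le[OF 2 q_sums[OF r(1)] 3] have "1 \<le> (Z * f t + Z / Z) / 2"
      by (simp only: r(2))
    then show "1 / Z \<le> f t" using Z_pos by (simp add: field_simps)
  qed (rule that)
  have "0 < l" using l(1) Z_pos by (meson divide_pos_pos less_le_trans zero_less_one)
  then show ?thesis using that l(2) unfolding f_def by blast
qed

text \<open>Survival becomes the event \<open>X t \<noteq> 0\<close> minus a countable union of
  events that turn out to be null. Rational times suffice, because by right-continuity a visit to
  \<open>0\<close> before \<open>t\<close> lasts through some rational time before
  \<open>t\<close>.\<close>

lemma less_extinction_time_iff:
  assumes \<omega>: "\<omega> \<in> space \<Omega>" and t: "0 \<le> t"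
  shows "ereal t < extinction_time X \<omega> \<longleftrightarrow>
    X t \<omega> \<noteq> 0 \<and> \<not> (\<exists>r\<in>\<rat> \<inter> {0..t}. X r \<omega> = 0 \<and> X t \<omega> \<noteq> 0)"
proof -
  have right: "\<exists>\<delta>>s. \<forall>r\<in>{s..<\<delta>}. X r \<omega> = X s \<omega>" if s: "0 \<le> s" for s
  proof -
    obtain \<delta> where "\<delta> > s" "\<forall>y>s. y < \<delta> \<longrightarrow> X y \<omega> = X s \<omega>"
      using right_continuous[OF \<omega> s] unfolding eventually_at_right_field by blast
    then show ?thesis by (intro exI[of _ \<delta>]) (auto simp: le_less)
  qed
  have "ereal t < extinction_time X \<omega> \<longleftrightarrow> (\<forall>s\<in>{0..t}. X s \<omega> \<noteq> 0)"
  proof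
    assume less: "ereal t < extinction_time X \<omega>"
    show "\<forall>s\<in>{0..t}. X s \<omega> \<noteq> 0"
    proof (intro ballI notI)
      fix s assume s: "s \<in> {0..t}" "X s \<omega> = 0"
      then have "extinction_time X \<omega> \<le> ereal s" unfolding extinction_time_def by (intro Inf_lower) auto
      also have "\<dots> \<le> ereal t" using s by simp
      finally show False using less by simp
    qed
  next
    assume nz: "\<forall>s\<in>{0..t}. X s \<omega> \<noteq> 0"
    \<comment> \<open>Right-continuity at \<open>t\<close> keeps the extinction time away from
      \<open>t\<close>, giving the strict inequality.\<close>
    obtain \<delta> where \<delta>: "\<delta> > t" "\<forall>r\<in>{t..<\<delta>}. X r \<omega> = X t \<omega>" using right[OF t] by blast
    have "ereal \<delta> \<le> extinction_time X \<omega>"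
      unfolding extinction_time_def
    proof (rule Inf_greatest)
      fix y assume "y \<in> ereal ` {t. 0 \<le> t \<and> X t \<omega> = 0}"
      then obtain s where s: "y = ereal s" "0 \<le> s" "X s \<omega> = 0" by auto
      have "\<delta> \<le> s"
      proof (rule ccontr)
        assume "\<not> \<delta> \<le> s"
        moreover have "\<not> s \<le> t" using bspec[OF nz, of s] s by auto
        ultimately have "X s \<omega> = X t \<omega>" using bspec[OF \<delta>(2), of s] by simp
        then show False using nz s t by simp
      qed
      then show "ereal \<delta> \<le> y" using s by simp
    qed
    moreover have "ereal t < ereal \<delta>" using \<delta>(1) by simp
    ultimately show "ereal t < extinction_time X \<omega>" by (rule less_le_trans[rotated])
  qed
  also have "\<dots> \<longleftrightarrow> X t \<omega> \<noteq> 0 \<and> \<not> (\<exists>r\<in>\<rat> \<inter> {0..t}. X r \<omega> = 0 \<and> X t \<omega> \<noteq> 0)"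
  proof
    assume "\<forall>s\<in>{0..t}. X s \<omega> \<noteq> 0"
    then show "X t \<omega> \<noteq> 0 \<and> \<not> (\<exists>r\<in>\<rat> \<inter> {0..t}. X r \<omega> = 0 \<and> X t \<omega> \<noteq> 0)" using t by auto
  next
    assume *: "X t \<omega> \<noteq> 0 \<and> \<not> (\<exists>r\<in>\<rat> \<inter> {0..t}. X r \<omega> = 0 \<and> X t \<omega> \<noteq> 0)"
    show "\<forall>s\<in>{0..t}. X s \<omega> \<noteq> 0"
    proof (intro ballI notI)
      fix s assume s: "s \<in> {0..t}" "X s \<omega> = 0"
      then have "s < t" using * by (cases "s = t") auto
      obtain \<delta> where \<delta>: "\<delta> > s" "\<forall>r\<in>{s..<\<delta>}. X r \<omega> = X s \<omega>" using right[of s] s by auto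
      obtain r where r: "r \<in> \<rat>" "s < r" "r < min t \<delta>"
        using Rats_dense_in_real[of s "min t \<delta>"] \<open>s < t\<close> \<delta>(1) by auto
      then have "X r \<omega> = 0" using bspec[OF \<delta>(2), of r] s by simp
      then show False using * r s by fastforce
    qed
  qed
  finally show ?thesis .
qed

section \<open>Random initial states and quasi-stationarity\<close>

lemma initial_law_kernel: "P \<in> measurable (measure_pmf \<rho>) (subprob_algebra \<Omega>)"
proof -
  have "P i \<in> space (subprob_algebra \<Omega>)" for i
    using prob_space_P[of i] sets_P[of i] by (auto simp: space_subprob_algebra prob_space_imp_subprob_space)
  then show ?thesis by simp
qed

lemma sets_initial_law: "sets (initial_law P \<rho>) = sets \<Omega>"
  unfolding initial_law_def using sets_P by (intro sets_bind) auto

lemma space_initial_law: "space (initial_law P \<rho>) = space \<Omega>"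
  using sets_initial_law by (rule sets_eq_imp_space_eq)

lemma finite_measure_initial_law: "finite_measure (initial_law P \<rho>)"
proof -
  have "prob_space (initial_law P \<rho>)"
    unfolding initial_law_def
    by (rule prob_space.prob_space_bind[OF measure_pmf.prob_space_axioms _ initial_law_kernel])
      (simp add: prob_space_P)
  then show ?thesis by (simp add: prob_space_def)
qed

lemma initial_law_sums:
  assumes "A \<in> sets \<Omega>"
  shows "(\<lambda>i. pmf \<rho> i * measure (P i) A) sums measure (initial_law P \<rho>) A"
proof -
  have le_1: "measure (P i) A \<le> 1" for i
    using prob_space.prob_le_1[OF prob_space_P] .
  have "(\<lambda>i. pmf \<rho> i) sums 1"
  proof -
    have "(\<lambda>i. measure (measure_pmf \<rho>) {x \<in> UNIV. x = i}) sums measure (measure_pmf \<rho>) UNIV"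
      by (intro measure_fibres_sums) (auto intro: measure_pmf.finite_measure_axioms)
    then show ?thesis by (simp add: measure_pmf_single)
  qed
  then have summable: "summable (\<lambda>i. pmf \<rho> i * measure (P i) A)"
    using le_1 by (intro summable_comparison_test'[OF sums_summable]) (auto intro: mult_left_le)
  have "measure (initial_law P \<rho>) A = (\<integral>i. measure (P i) A \<partial>measure_pmf \<rho>)"
    unfolding initial_law_def
    by (rule subprob_space.measure_bind[OF measure_pmf.subprob_space_axioms initial_law_kernel assms])
  also have "\<dots> = (\<integral>i. pmf \<rho> i * measure (P i) A \<partial>count_space UNIV)"
    unfolding measure_pmf_eq_density by (subst integral_density) auto
  also have "\<dots> = (\<Sum>i. pmf \<rho> i * measure (P i) A)"
    using summable by (intro sums_unique sums_integral_count_space_nat) (simp add: integrable_count_space_nat_iff)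
  finally show ?thesis using summable by (simp add: sums_iff)
qed

text \<open>For weights proportional to \<open>\<pi> * q\<close>, reversibility turns the law at
  time \<open>t\<close> into the eigenvalue identity for \<open>q\<close>. Each positive state keeps
  its mass up to the common factor \<open>exp (- \<xi> * t)\<close>.\<close>

lemma quasi_stationary:
  obtains \<rho> where "quasi_stationary_distribution P X \<rho>"
proof -
  define Z where "Z = (\<Sum>n. \<pi> n * q n)"
  have Z_pos: "0 < Z"
    unfolding Z_def using summable_pi_q pi_nonneg q_nonneg pi_1 by (intro suminf_pos2[of _ 1]) auto
  define r where "r n = \<pi> n * q n / Z" for n
  have r_nonneg: "0 \<le> r n" for n using pi_nonneg q_nonneg Z_pos by (simp add: r_def)
  have r_sums: "r sums 1"
    using sums_divide[OF summable_sums[OF summable_pi_q], of Z] Z_pos by (simp add: r_def[abs_def] Z_def)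
  define \<rho> where "\<rho> = embed_pmf r"
  have pmf_\<rho>: "pmf \<rho> n = r n" for n
    unfolding \<rho>_def
  proof (rule pmf_embed_pmf)
    show "(\<integral>\<^sup>+ n. ennreal (r n) \<partial>count_space UNIV) = 1"
      using suminf_ennreal_eq[OF r_nonneg r_sums] by (simp add: nn_integral_count_space_nat)
  qed (rule r_nonneg)
  let ?M = "initial_law P \<rho>"
  have marginal: "measure ?M {\<omega> \<in> space \<Omega>. X t \<omega> = j} = exp (- \<xi> * t) * pmf \<rho> j"
    if "0 \<le> t" "1 \<le> j" for t j
  proof -
    have "(\<lambda>i. \<pi> j / Z * (p t j i * q i)) sums (\<pi> j / Z * (exp (- \<xi> * t) * q j))"
      by (intro sums_mult p_q_sums that)
    moreover have "\<pi> j / Z * (p t j i * q i) = pmf \<rho> i * p t i j" for i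
    proof (cases "i = 0")
      case False
      then show ?thesis using p_reversible[of j i t] that by (simp add: pmf_\<rho> r_def)
    qed (simp add: pmf_\<rho> r_def)
    moreover have "\<pi> j / Z * (exp (- \<xi> * t) * q j) = exp (- \<xi> * t) * pmf \<rho> j"
      by (simp add: pmf_\<rho> r_def)
    ultimately have "(\<lambda>i. pmf \<rho> i * p t i j) sums (exp (- \<xi> * t) * pmf \<rho> j)"
      by (simp only:)
    then show ?thesis
      using initial_law_sums[OF sets_X_eq[OF that(1)], of \<rho> j] unfolding p_def by (rule sums_unique2[symmetric])
  qed
  have survival: "measure ?M {\<omega> \<in> space \<Omega>. X t \<omega> \<in> A \<and> ereal t < extinction_time X \<omega>}
      = exp (- \<xi> * t) * measure (measure_pmf \<rho>) A" if t: "0 \<le> t" for t A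
  proof -
    define E where "E = {\<omega> \<in> space \<Omega>. X t \<omega> \<in> A - {0}}"
    \<comment> \<open>\<open>D\<close> collects the paths that visit \<open>0\<close> at a rational
      time and are away from it at time \<open>t\<close>; absorption makes it null.\<close>
    define D where "D = {\<omega> \<in> space \<Omega>. \<exists>r\<in>\<rat> \<inter> {0..t}. X r \<omega> = 0 \<and> X t \<omega> \<noteq> 0}"
    have D_eq: "D = (\<Union>r\<in>\<rat> \<inter> {0..t}. {\<omega> \<in> space \<Omega>. X r \<omega> \<in> {0}} \<inter> {\<omega> \<in> space \<Omega>. X t \<omega> \<in> - {0}})"
      by (auto simp: D_def)
    have D_sets: "D \<in> sets \<Omega>"
      unfolding D_eq
      by (intro sets.countable_UN'' sets.Int sets_X countable_Int1 countable_rat) (use t in auto)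
    have "measure (P i) D = 0" for i
    proof -
      have "AE \<omega> in P i. \<forall>r\<in>\<rat> \<inter> {0..t}. X r \<omega> = 0 \<longrightarrow> X t \<omega> = 0"
        by (subst AE_ball_countable) (auto intro: countable_Int1 countable_rat AE_absorbed)
      then have "AE \<omega> in P i. \<omega> \<notin> D" by eventually_elim (auto simp: D_def)
      then show ?thesis
        using D_sets by (simp add: AE_iff_null_sets[symmetric] sets_P null_setsD1 measure_eq_0_null_sets)
    qed
    then have "measure ?M D = 0" using initial_law_sums[OF D_sets, of \<rho>] sums_unique2[OF sums_zero] by auto
    then have D_null: "D \<in> null_sets ?M"
      using D_sets finite_measure.emeasure_eq_measure[OF finite_measure_initial_law]
      by (intro null_setsI) (auto simp: sets_initial_law)
    have "{\<omega> \<in> space \<Omega>. X t \<omega> \<in> A \<and> ereal t < extinction_time X \<omega>} = E - D"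
      using less_extinction_time_iff[OF _ t] unfolding E_def D_def by blast
    then have "measure ?M {\<omega> \<in> space \<Omega>. X t \<omega> \<in> A \<and> ereal t < extinction_time X \<omega>} = measure ?M E"
      using measure_Diff_null_set[OF _ D_null, of E] sets_X[OF t, of "A - {0}"]
      by (simp add: E_def sets_initial_law)
    also have "\<dots> = exp (- \<xi> * t) * measure (measure_pmf \<rho>) A"
    proof (rule sums_unique2)
      have "X t \<in> measurable ?M (count_space UNIV)"
        using measurable_X[OF t] measurable_cong_sets[OF sets_initial_law refl] by blast
      then show "(\<lambda>j. measure ?M {\<omega> \<in> E. X t \<omega> = j}) sums measure ?M E"
        using sets_X[OF t, of "A - {0}"] by (intro measure_fibres_sums finite_measure_initial_law)
          (simp_all only: E_def sets_initial_law)
      have "(\<lambda>j. measure (measure_pmf \<rho>) {x \<in> A. x = j}) sums measure (measure_pmf \<rho>) A"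
        by (intro measure_fibres_sums) (auto intro: measure_pmf.finite_measure_axioms)
      then have "(\<lambda>j. exp (- \<xi> * t) * measure (measure_pmf \<rho>) {x \<in> A. x = j})
          sums (exp (- \<xi> * t) * measure (measure_pmf \<rho>) A)" by (rule sums_mult)
      moreover have "exp (- \<xi> * t) * measure (measure_pmf \<rho>) {x \<in> A. x = j}
          = measure ?M {\<omega> \<in> E. X t \<omega> = j}" for j
      proof (cases "j \<in> A \<and> j \<noteq> 0")
        case True
        then have "{x \<in> A. x = j} = {j}" "{\<omega> \<in> E. X t \<omega> = j} = {\<omega> \<in> space \<Omega>. X t \<omega> = j}"
          by (auto simp: E_def)
        then show ?thesis using marginal[OF t, of j] True by (simp add: measure_pmf_single)
      next
        case False
        \<comment> \<open>The set is empty or \<open>{0}\<close>, and \<open>\<rho>\<close> has no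
          mass at \<open>0\<close>.\<close>
        then have "{x \<in> A. x = j} \<subseteq> {0}" and E: "{\<omega> \<in> E. X t \<omega> = j} = {}"
          by (auto simp: E_def)
        then have "measure (measure_pmf \<rho>) {x \<in> A. x = j} \<le> measure (measure_pmf \<rho>) {0}"
          by (intro measure_pmf.finite_measure_mono) auto
        also have "\<dots> = 0" by (simp add: measure_pmf_single pmf_\<rho> r_def)
        finally have "measure (measure_pmf \<rho>) {x \<in> A. x = j} = 0" by (simp add: measure_le_0_iff)
        then show ?thesis unfolding E by simp
      qed
      ultimately show "(\<lambda>j. measure ?M {\<omega> \<in> E. X t \<omega> = j})
          sums (exp (- \<xi> * t) * measure (measure_pmf \<rho>) A)" by simp
    qed
    finally show ?thesis .
  qed
  have "quasi_stationary_distribution P X \<rho>"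
    unfolding quasi_stationary_distribution_def
  proof (intro conjI allI impI)
    show "0 \<notin> set_pmf \<rho>" by (simp add: set_pmf_iff pmf_\<rho> r_def)
    fix t :: real and A assume t: "0 \<le> t"
    show "cond_prob ?M (\<lambda>\<omega>. X t \<omega> \<in> A) (\<lambda>\<omega>. ereal t < extinction_time X \<omega>) = measure (measure_pmf \<rho>) A"
      \<comment> \<open>The case \<open>UNIV\<close> gives the survival probability
        \<open>exp (- \<xi> * t)\<close>, which cancels in the quotient.\<close>
      using survival[OF t, of A] survival[OF t, of UNIV]
      by (simp add: cond_prob_def space_initial_law)
  qed
  then show ?thesis by (rule that)
qed

end

theorem theorem2p3:
  fixes b d :: "nat \<Rightarrow> real"
    and \<Omega> :: "'w measure"
    and P :: "nat \<Rightarrow> 'w measure"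
    and X :: "real \<Rightarrow> 'w \<Rightarrow> nat"
    and C lambda1 :: real
    and \<phi> :: "nat \<Rightarrow> real"
  assumes "b 0 = 0" and "d 0 = 0"
    and "\<And>i. i \<ge> 1 \<Longrightarrow> b i > 0" and "\<And>i. i \<ge> 1 \<Longrightarrow> d i > 0"
    and "filterlim (\<lambda>N. \<Sum>n=1..N. (\<Prod>k=1..n. d k) / (\<Prod>k=1..n. b k)) at_top sequentially"
    and "birth_death_process b d \<Omega> P X"
    and "C > 0" and "lambda1 > d 1"
    and "\<And>i. \<phi> i \<ge> 0"
    and "filterlim \<phi> at_top sequentially"
    and "\<And>i. i \<ge> 1 \<Longrightarrow> generator b d \<phi> i \<le> - lambda1 * \<phi> i + C"
  shows "(\<exists>\<rho>. quasi_stationary_distribution P X \<rho>) \<and> xi1_positive_recurrent b d P X"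
proof -
  interpret birth_death_process b d \<Omega> P X by fact
  interpret lyapunov_birth_death b d C lambda1 \<phi> \<Omega> P X
    by unfold_locales (use assms in auto)
  obtain \<rho> where "quasi_stationary_distribution P X \<rho>" by (rule quasi_stationary)
  moreover obtain l where l: "0 < l" "((\<lambda>t. exp (\<xi> * t) * p t 1 1) \<longlongrightarrow> l) at_top"
    by (rule return_probability_tendsto)
  have "xi1_positive_recurrent b d P X"
    unfolding xi1_positive_recurrent_def
  proof (intro conjI exI[of _ "1::nat"] exI[of _ l])
    show "0 < xi1 b d" using xi_pos by (simp add: \<xi>_def)
    show "((\<lambda>t. exp (xi1 b d * t) * measure (P 1) {\<omega> \<in> space (P 1). X t \<omega> = 1}) \<longlongrightarrow> l) at_top"
      using l(2) by (simp add: \<xi>_def p_def space_P)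
  qed (use l in auto)
  ultimately show ?thesis by blast
qed

end
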